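(* For $N\ge 2$ let $-1<\tau_1<\tau_2<\cdots<\tau_{N-1}<1$ be the zeros of the Jacobi polynomial $P_{N-1}^{(1,0)}$, and set $\tau_N=1$ (these $N$ points are the Radau quadrature points on $(-1,+1]$). Then the Lebesgue constant of the point set $\{\tau_1,\dots,\tau_N\}$ is $O(\sqrt{N})$; that is, there is a constant $C$ independent of $N$ such that it is at most $C\sqrt{N}$ for all $N\ge 2$.
   Context: For $\alpha,\beta>-1$, the Jacobi polynomials $P_n^{(\alpha,\beta)}$ are the polynomials of degree $n$ orthogonal on $[-1,1]$ with respect to the weight $(1-\tau)^\alpha(1+\tau)^\beta$, with the standard normalization $P_n^{(\alpha,\beta)}(1)=\binom{n+\alpha}{n}$ (so $P_{N-1}^{(1,0)}(1)=N$). For a set of distinct points $\{t_1,\dots,t_N\}\subset[-1,1]$ with Lagrange polynomials $R_i(\tau)=\prod_{j\ne i}\frac{\tau-t_j}{t_i-t_j}$, the Lebesgue constant is $\max\{\sum_{i=1}^N|R_i(\tau)|:\tau\in[-1,1]\}$. *)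

theory Defs
  imports "HOL-Analysis.Analysis"
begin

text \<open>Jacobi polynomial P_n^(alpha,beta), standard normalization P_n(1) = binom(n+alpha, n),
  given by the classical explicit formula (DLMF 18.5.8).\<close>
definition jacobiP :: "nat \<Rightarrow> real \<Rightarrow> real \<Rightarrow> real \<Rightarrow> real" where
  "jacobiP n \<alpha> \<beta> x =
     (\<Sum>s\<le>n. ((real n + \<alpha>) gchoose (n - s)) * ((real n + \<beta>) gchoose s)
               * ((x - 1) / 2) ^ s * ((x + 1) / 2) ^ (n - s))"

definition lagrange_basis :: "nat \<Rightarrow> (nat \<Rightarrow> real) \<Rightarrow> nat \<Rightarrow> real \<Rightarrow> real" where
  "lagrange_basis N t i x = (\<Prod>j\<in>{1..N} - {i}. (x - t j) / (t i - t j))"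

definition lebesgue_constant :: "nat \<Rightarrow> (nat \<Rightarrow> real) \<Rightarrow> real" where
  "lebesgue_constant N t =
     (SUP x\<in>{-1..1}. \<Sum>i=1..N. \<bar>lagrange_basis N t i x\<bar>)"

end

theory Submission
  imports Defs
begin

text \<open>
  With \<open>n = N - 1\<close>, the polynomials \<open>J = P_n^(1,0)\<close> and \<open>K = P_n^(0,1)\<close> satisfy
  \<open>((1 - x) J)' = - N K\<close> and \<open>((1 + x) K)' = N J\<close>. The node polynomial is a multiple of
  \<open>\<omega> = (1 - x) J\<close>, so \<open>\<omega>' = - N K\<close> at the nodes. Differentiating \<open>\<omega>' / \<omega>\<close> gives the exact
  identity \<open>\<Sum>i. R_i(x)\<^sup>2 G(t_i) = G(x)\<close> with \<open>G = (1 - x) J\<^sup>2 + (1 + x) K\<^sup>2\<close>.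

  Away from the end points, \<open>sqrt (1 - x\<^sup>2) G(x)\<close> is comparable to \<open>1 / N\<close>: its derivative oscillates, and
  subtracting the lower order term \<open>sqrt (1 - x\<^sup>2) J K / N\<close> leaves a quantity whose logarithmic
  derivative is dominated by that of \<open>exp (1 / (N sqrt (1 - x\<^sup>2)))\<close>. Hence Cauchy-Schwarz bounds by
  \<open>O(sqrt N)\<close> the contribution of the nodes with \<open>1 - t_i\<^sup>2 \<le> 4 (1 - x\<^sup>2)\<close>.
  For all other nodes \<open>\<bar>x - t_i\<bar>\<close> is at least half the distance of \<open>t_i\<close> from the end point closest to
  \<open>x\<close>, and \<open>R_i(x) = \<omega>(x) / (N K(t_i) (t_i - x))\<close> is estimated directly, using
  \<open>1 + t_i \<ge> i\<^sup>2 / (2 N\<^sup>2)\<close> near \<open>-1\<close> and \<open>\<Sum>i<N. 1 / (1 - t_i) = (N\<^sup>2 - 1) / 4\<close> near \<open>1\<close>.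
\<close>

subsection \<open>The first-order system of a pair of Jacobi polynomials\<close>

text \<open>Models \<open>J = P_n^(1,0)\<close>, \<open>K = P_n^(0,1)\<close> and
  \<open>N = n + 1\<close>. The axioms are invariant under reflection with \<open>J\<close> and
  \<open>K\<close> exchanged; the end values enter as squares because reflection introduces the sign
  \<open>(- 1) ^ n\<close>.\<close>

locale jacobi_pair =
  fixes J K J' K' :: "real \<Rightarrow> real" and N :: real
  assumes N_ge_1: "N \<ge> 1"
    and DERIV_J: "(J has_real_derivative J' x) (at x)"
    and DERIV_K: "(K has_real_derivative K' x) (at x)"
    and J_ode: "(1 - x) * J' x = J x - N * K x"
    and K_ode: "(1 + x) * K' x = N * J x - K x"
    and K_1: "(K 1)\<^sup>2 = 1"
    and J_minus_1: "(J (- 1))\<^sup>2 = 1"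
begin

text \<open>Reflection exchanges the two equations, so a bound proved on the right half of the
  interval carries over to the left half.\<close>

lemma mirror: "jacobi_pair (\<lambda>x. K (- x)) (\<lambda>x. J (- x)) (\<lambda>x. - K' (- x)) (\<lambda>x. - J' (- x)) N"
proof
  show "((\<lambda>x. K (- x)) has_real_derivative - K' (- x)) (at x)"
    and "((\<lambda>x. J (- x)) has_real_derivative - J' (- x)) (at x)" for x
    using DERIV_J DERIV_K by (simp_all flip: DERIV_mirror)
  show "(1 - x) * (- K' (- x)) = K (- x) - N * J (- x)"
    and "(1 + x) * (- J' (- x)) = N * K (- x) - J (- x)" for x
    using K_ode[of "-x"] J_ode[of "-x"] by (simp_all add: algebra_simps)
qed (use N_ge_1 K_1 J_minus_1 in auto)

text \<open>An energy of the system. At every Radau node the first summand vanishes, so there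
  \<open>G\<close> is \<open>(1 + x) * (K x)\<^sup>2\<close> and controls the derivative of the node
  polynomial.\<close>

definition G :: "real \<Rightarrow> real" where
  "G x = (1 - x) * (J x)\<^sup>2 + (1 + x) * (K x)\<^sup>2"

lemma G_minus_1: "G (- 1) = 2" and G_1: "G 1 = 2"
  by (simp_all add: G_def J_minus_1 K_1)

lemma G_nonneg: "\<bar>x\<bar> \<le> 1 \<Longrightarrow> G x \<ge> 0"
  by (simp add: G_def)

text \<open>The mixed terms \<open>- 2 * N * J x * K x\<close> and \<open>2 * N * J x * K x\<close>
  coming from the two equations cancel, so no factor \<open>N\<close> is left.\<close>

lemma DERIV_G: "(G has_real_derivative (J x)\<^sup>2 - (K x)\<^sup>2) (at x)"
proof -
  have "(G has_real_derivative 2 * J x * ((1 - x) * J' x) - (J x)\<^sup>2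
          + 2 * K x * ((1 + x) * K' x) + (K x)\<^sup>2) (at x)"
    unfolding G_def
    by (rule derivative_eq_intros DERIV_J DERIV_K refl)+ (simp add: algebra_simps power2_eq_square)
  then show ?thesis
    unfolding J_ode K_ode by (simp add: algebra_simps power2_eq_square)
qed

section \<open>Monotone multiples of \<open>G\<close> and first bounds\<close>

lemma DERIV_G_plus: "((\<lambda>x. (1 + x) * G x) has_real_derivative 2 * (J x)\<^sup>2) (at x)"
  by (rule derivative_eq_intros DERIV_G refl)+ (simp add: G_def algebra_simps)

lemma DERIV_G_minus: "((\<lambda>x. (1 - x) * G x) has_real_derivative - 2 * (K x)\<^sup>2) (at x)"
  by (rule derivative_eq_intros DERIV_G refl)+ (simp add: G_def algebra_simps)

lemma G_plus_mono: "x \<le> y \<Longrightarrow> (1 + x) * G x \<le> (1 + y) * G y"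
  by (rule DERIV_nonneg_imp_nondecreasing) (use DERIV_G_plus in fastforce)+

lemma G_minus_antimono: "x \<le> y \<Longrightarrow> (1 - y) * G y \<le> (1 - x) * G x"
  by (rule DERIV_nonpos_imp_nonincreasing)
     (use DERIV_G_minus in \<open>force intro!: exI\<close>)+

text \<open>Compare \<open>(1 + x) * G x\<close> with its value at \<open>1\<close> and
  \<open>(1 - x) * G x\<close> with its value at \<open>- 1\<close>; both values are
  \<open>4\<close>, and the two bounds add up to \<open>2 * G x \<le> 8\<close>.\<close>

lemma G_le_4:
  assumes "\<bar>x\<bar> \<le> 1" shows "G x \<le> 4"
proof -
  have "(1 + x) * G x \<le> 4" "(1 - x) * G x \<le> 4"
    using G_plus_mono[of x 1] G_minus_antimono[of "-1" x] assms by (auto simp: G_1 G_minus_1)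
  then show ?thesis
    by (simp add: algebra_simps)
qed

lemma sq_J_le:
  assumes "\<bar>x\<bar> \<le> 1" shows "((1 - x) * J x)\<^sup>2 \<le> (1 - x) * G x"
proof -
  have "0 \<le> (1 - x) * ((1 + x) * (K x)\<^sup>2)"
    using assms by simp
  then show ?thesis
    by (simp add: G_def power2_eq_square algebra_simps)
qed

lemma abs_J_le_2:
  assumes "\<bar>x\<bar> \<le> 1" shows "\<bar>(1 - x) * J x\<bar> \<le> 2"
proof -
  have "((1 - x) * J x)\<^sup>2 \<le> 2\<^sup>2"
    using sq_J_le[OF assms] G_minus_antimono[of "-1" x] assms by (simp add: G_minus_1 abs_le_iff)
  then show ?thesis
    using abs_le_square_iff[of "(1 - x) * J x" 2] by simp
qed

lemma abs_K_le_2: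
  assumes "0 \<le> x" "x \<le> 1" shows "\<bar>K x\<bar> \<le> 2"
proof -
  have "(1 + x) * (K x)\<^sup>2 \<le> G x"
    using assms by (simp add: G_def)
  moreover have "(K x)\<^sup>2 \<le> (1 + x) * (K x)\<^sup>2"
    using assms by (simp add: algebra_simps)
  ultimately have "(K x)\<^sup>2 \<le> 2\<^sup>2"
    using G_le_4[of x] assms by simp
  then show ?thesis
    using abs_le_square_iff[of "K x" 2] by simp
qed

text \<open>\<open>(1 - x) * J x\<close> vanishes at \<open>1\<close> and has derivative
  \<open>- N * K x\<close>, so the mean value theorem gives \<open>J x = N * K z\<close> for some
  \<open>z\<close> between \<open>x\<close> and \<open>1\<close>.\<close>

lemma abs_J_le:
  assumes "0 \<le> x" "x < 1" shows "\<bar>J x\<bar> \<le> 2 * N"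
proof -
  have D: "((\<lambda>x. (1 - x) * J x) has_real_derivative - N * K y) (at y)" for y
    by (rule derivative_eq_intros DERIV_J refl)+ (use J_ode[of y] in \<open>simp add: algebra_simps\<close>)
  obtain z where z: "x < z" "z < 1" "(1 - 1) * J 1 - (1 - x) * J x = (1 - x) * (- N * K z)"
    using MVT2[OF assms(2) D] by blast
  then have "(1 - x) * (J x - N * K z) = 0"
    by (simp add: algebra_simps)
  then have "J x = N * K z"
    using assms by simp
  then show ?thesis
    using abs_K_le_2[of z] z assms N_ge_1 by (simp add: abs_mult)
qed

section \<open>The boundary layer next to \<open>1\<close>\<close>

lemma G_near_1: "G (1 - 1 / (4 * N\<^sup>2)) \<ge> 1"
proof -
  define x where "x = 1 - 1 / (4 * N\<^sup>2)"
  have N2: "N\<^sup>2 \<ge> 1" using N_ge_1 by simp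
  have "1 / (4 * N\<^sup>2) \<le> 1 / 1" "1 / (4 * N\<^sup>2) > 0"
    using N2 by (intro divide_left_mono divide_pos_pos; linarith)+
  then have x: "0 \<le> x" "x < 1" by (simp_all add: x_def)
  \<comment> \<open>\<open>(1 + x) * G x\<close> is \<open>4\<close> at \<open>1\<close> and its
    slope \<open>2 * (J z)\<^sup>2\<close> is at most \<open>8 * N\<^sup>2\<close>; over the length
    \<open>1 / (4 * N\<^sup>2)\<close> it drops by at most \<open>2\<close>.\<close>
  obtain z where z: "x < z" "z < 1" "(1 + 1) * G 1 - (1 + x) * G x = (1 - x) * (2 * (J z)\<^sup>2)"
    using MVT2[OF x(2) DERIV_G_plus] by blast
  have "(J z)\<^sup>2 \<le> (2 * N)\<^sup>2"
    using abs_J_le[of z] z x N_ge_1 by (intro power2_le_iff_abs_le[THEN iffD2]) auto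
  then have "(1 - x) * (2 * (J z)\<^sup>2) \<le> (1 - x) * (8 * N\<^sup>2)"
    using x by (intro mult_left_mono) auto
  also have "\<dots> = 2"
    using N_ge_1 by (simp add: x_def)
  finally have "(1 + x) * G x \<ge> 2"
    using z by (simp add: G_1)
  moreover have "(1 + x) * G x \<le> 2 * G x"
    using x G_nonneg[of x] by (intro mult_right_mono) auto
  ultimately show ?thesis by (simp add: x_def)
qed

text \<open>By monotonicity \<open>(1 - x) * G x\<close> is at least its value at the point of
  \<open>G_near_1\<close>, hence at least \<open>1 / (4 * N\<^sup>2)\<close>. The factor
  \<open>1 + x \<ge> 1\<close> completes it to \<open>w * w * G x\<close>, and one factor
  \<open>w\<close> is then traded for \<open>1 / N\<close>.\<close>

lemma weighted_G_ge_near_1: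
  assumes "0 \<le> x" "x \<le> 1 - 1 / (4 * N\<^sup>2)" "N * sqrt (1 - x\<^sup>2) \<le> 1"
  shows "sqrt (1 - x\<^sup>2) * G x \<ge> 1 / (4 * N)"
proof -
  define w where "w = sqrt (1 - x\<^sup>2)"
  have N: "N > 0" using N_ge_1 by simp
  have "x < 1" using assms N by (smt (verit) divide_pos_pos zero_less_power)
  then have x2: "1 - x\<^sup>2 > 0" using assms by (simp add: power_less_one_iff abs_square_less_1)
  then have w: "w > 0" "w * w = 1 - x\<^sup>2" by (simp_all add: w_def)
  have "1 / (4 * N\<^sup>2) \<le> (1 - (1 - 1 / (4 * N\<^sup>2))) * G (1 - 1 / (4 * N\<^sup>2))"
    using mult_left_mono[OF G_near_1, of "1 / (4 * N\<^sup>2)"] by simp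
  also have "\<dots> \<le> (1 - x) * G x"
    by (rule G_minus_antimono) (use assms in simp)
  also have "\<dots> \<le> (1 + x) * ((1 - x) * G x)"
  proof -
    have "0 \<le> x * ((1 - x) * G x)"
      using assms(1) \<open>x < 1\<close> G_nonneg[of x] by simp
    then show ?thesis by (simp add: algebra_simps)
  qed
  also have "\<dots> = w * w * G x"
    by (simp add: w algebra_simps power2_eq_square)
  finally have "1 / (4 * N) \<le> (N * w) * (w * G x)"
    using N by (simp add: field_simps power2_eq_square)
  also have "\<dots> \<le> 1 * (w * G x)"
    using assms w G_nonneg[of x] \<open>x < 1\<close> by (intro mult_right_mono) (auto simp: w_def)
  finally show ?thesis by (simp add: w_def)
qed

lemma weighted_G_le_near_1:
  assumes "0 \<le> x" "x < 1" "N * sqrt (1 - x\<^sup>2) \<le> 1"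
  shows "sqrt (1 - x\<^sup>2) * G x \<le> 4 / N"
proof -
  have "sqrt (1 - x\<^sup>2) \<le> 1 / N"
    using assms N_ge_1 by (simp add: field_simps)
  then have "sqrt (1 - x\<^sup>2) * G x \<le> 1 / N * 4"
    using G_le_4[of x] G_nonneg[of x] assms N_ge_1 by (intro mult_mono) auto
  then show ?thesis by simp
qed

section \<open>The corrected quantity \<open>H\<close> and its slow variation\<close>

definition H :: "real \<Rightarrow> real" where
  "H x = sqrt (1 - x\<^sup>2) * (G x - J x * K x / N)"

text \<open>AM-GM for the two summands of \<open>G\<close>.\<close>

lemma abs_JK_le:
  assumes "\<bar>x\<bar> < 1" shows "\<bar>J x * K x\<bar> \<le> G x / (2 * sqrt (1 - x\<^sup>2))"
proof -
  have "0 \<le> (sqrt (1 - x) * \<bar>J x\<bar> - sqrt (1 + x) * \<bar>K x\<bar>)\<^sup>2"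
    by simp
  also have "\<dots> = G x - 2 * (sqrt (1 - x) * sqrt (1 + x)) * \<bar>J x * K x\<bar>"
    using assms by (simp add: G_def power2_diff power_mult_distrib abs_mult)
  also have "sqrt (1 - x) * sqrt (1 + x) = sqrt (1 - x\<^sup>2)"
    by (simp flip: real_sqrt_mult add: algebra_simps power2_eq_square)
  finally show ?thesis
    using assms by (simp add: field_simps abs_square_less_1)
qed

text \<open>The derivative of \<open>sqrt (1 - x\<^sup>2) * G x\<close> is \<open>((1 - x) * (J
  x)\<^sup>2 - (1 + x) * (K x)\<^sup>2) / sqrt (1 - x\<^sup>2)\<close>, which oscillates. The
  correction term in \<open>H\<close> has the same leading derivative, so only a remainder with the
  factor \<open>1 / N\<close> survives.\<close>

lemma DERIV_H:
  assumes "\<bar>x\<bar> < 1"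
  shows "(H has_real_derivative - x * (J x * K x) / (N * sqrt (1 - x\<^sup>2))) (at x)"
proof -
  define w where "w = sqrt (1 - x\<^sup>2)"
  have x2: "1 - x\<^sup>2 > 0"
    using assms by (simp add: abs_square_less_1)
  then have w: "w > 0" "w\<^sup>2 = 1 - x\<^sup>2" by (simp_all add: w_def)
  have ne: "1 - x \<noteq> 0" "1 + x \<noteq> 0" "N \<noteq> 0" using assms N_ge_1 by auto
  have J': "J' x = (J x - N * K x) / (1 - x)" and K': "K' x = (N * J x - K x) / (1 + x)"
    using ne J_ode[of x] K_ode[of x] by (simp_all add: field_simps)
  have "(H has_real_derivative - x / w * (G x - J x * K x / N)
          + w * ((J x)\<^sup>2 - (K x)\<^sup>2 - (J' x * K x + J x * K' x) / N)) (at x)"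
    unfolding H_def using x2 ne
    by (auto intro!: derivative_eq_intros DERIV_J DERIV_K DERIV_G simp: w_def field_simps)
  also have "- x / w * (G x - J x * K x / N)
          + w * ((J x)\<^sup>2 - (K x)\<^sup>2 - (J' x * K x + J x * K' x) / N)
      = (- x * (G x - J x * K x / N) + w\<^sup>2 * ((J x)\<^sup>2 - (K x)\<^sup>2 - (J' x * K x + J x * K' x) / N)) / w"
    using w by (simp add: field_simps power2_eq_square)
  also have "w\<^sup>2 * ((J x)\<^sup>2 - (K x)\<^sup>2 - (J' x * K x + J x * K' x) / N) =
      w\<^sup>2 * ((J x)\<^sup>2 - (K x)\<^sup>2) - ((1 + x) * (((1 - x) * J' x) * K x) + (1 - x) * (J x * ((1 + x) * K' x))) / N"
    unfolding w(2) using ne by (simp add: field_simps power2_eq_square)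
  also have "- x * (G x - J x * K x / N) + \<dots> = - x * (J x * K x) / N"
    using ne unfolding w(2) J_ode K_ode by (simp add: G_def field_simps power2_eq_square)
  finally show ?thesis by (simp add: w_def)
qed

text \<open>The correction is at most \<open>G x / (2 * N)\<close> by AM-GM, which is at most half
  of \<open>sqrt (1 - x\<^sup>2) * G x\<close> outside the boundary layer.\<close>

lemma H_bounds:
  assumes "\<bar>x\<bar> < 1" "N * sqrt (1 - x\<^sup>2) \<ge> 1"
  shows "sqrt (1 - x\<^sup>2) * G x \<le> 2 * H x" "2 * H x \<le> 3 * (sqrt (1 - x\<^sup>2) * G x)"
proof -
  define w where "w = sqrt (1 - x\<^sup>2)"
  have w: "w > 0"
    using assms by (simp add: w_def abs_square_less_1)
  have G: "G x \<ge> 0" using G_nonneg assms by simp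
  have "\<bar>w * (J x * K x / N)\<bar> \<le> G x / (2 * N)"
    using abs_JK_le[OF assms(1)] w N_ge_1 by (simp add: w_def abs_mult field_simps)
  also have "\<dots> \<le> (N * w) * (G x / (2 * N))"
    using assms(2) G N_ge_1 w_def mult_right_mono[of 1 "N * sqrt (1 - x\<^sup>2)" "G x / (2 * N)"] by auto
  also have "\<dots> = w * G x / 2" using N_ge_1 by simp
  finally show "sqrt (1 - x\<^sup>2) * G x \<le> 2 * H x" "2 * H x \<le> 3 * (sqrt (1 - x\<^sup>2) * G x)"
    unfolding H_def w_def[symmetric] right_diff_distrib by linarith+
qed

text \<open>A Gronwall argument: with \<open>\<psi> z = 1 / (N * sqrt (1 - z\<^sup>2))\<close> the
  derivative of \<open>H\<close> is bounded in absolute value by \<open>H\<close> times that of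
  \<open>\<psi>\<close>. Since \<open>\<psi>\<close> stays in \<open>[0, 1]\<close> on the range
  considered, \<open>H\<close> varies by a factor of at most \<open>exp 1\<close>.\<close>

lemma H_exp_mono:
  assumes "0 \<le> x" "x \<le> y" "y < 1" "N * sqrt (1 - y\<^sup>2) \<ge> 1"
  shows "H x * exp (1 / (N * sqrt (1 - x\<^sup>2))) \<le> H y * exp (1 / (N * sqrt (1 - y\<^sup>2)))"
    and "H y * exp (- (1 / (N * sqrt (1 - y\<^sup>2)))) \<le> H x * exp (- (1 / (N * sqrt (1 - x\<^sup>2))))"
proof -
  define \<psi> where "\<psi> z = 1 / (N * sqrt (1 - z\<^sup>2))" for z
  have N: "N > 0" using N_ge_1 by simp
  have *: "\<exists>d d'. (H has_real_derivative d) (at z) \<and> (\<psi> has_real_derivative d') (at z) \<and> \<bar>d\<bar> \<le> H z * d'"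
    if z: "x \<le> z" "z \<le> y" for z
  proof (intro exI conjI)
    define w where "w = sqrt (1 - z\<^sup>2)"
    have z1: "\<bar>z\<bar> < 1" "0 \<le> z" using z assms by auto
    then have w: "w > 0" "w\<^sup>2 = 1 - z\<^sup>2" by (simp_all add: w_def abs_square_less_1 abs_square_le_1)
    have "z\<^sup>2 \<le> y\<^sup>2" using z z1 by (intro power_mono) auto
    then have "N * sqrt (1 - y\<^sup>2) \<le> N * w"
      unfolding w_def using N by (intro mult_left_mono) auto
    then have Nw: "N * w \<ge> 1" using assms by simp
    show "(H has_real_derivative - z * (J z * K z) / (N * w)) (at z)"
      using DERIV_H[OF z1(1)] by (simp add: w_def)
    show "(\<psi> has_real_derivative z / (N * w ^ 3)) (at z)"
      unfolding \<psi>_def using w N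
      by (auto intro!: derivative_eq_intros simp: w_def field_simps power2_eq_square power3_eq_cube)
    have "\<bar>- z * (J z * K z) / (N * w)\<bar> = z / (N * w) * \<bar>J z * K z\<bar>"
      using z1 w N by (simp add: abs_mult)
    also have "\<dots> \<le> z / (N * w) * (G z / (2 * w))"
      using abs_JK_le[OF z1(1)] z1 w N by (intro mult_left_mono) (auto simp: w_def)
    also have "\<dots> = z / (N * w ^ 3) * (w * G z / 2)"
      using w by (simp add: field_simps power3_eq_cube)
    also have "\<dots> \<le> z / (N * w ^ 3) * H z"
      using H_bounds(1)[OF z1(1)] Nw z1 w N by (intro mult_left_mono) (auto simp: w_def)
    finally show "\<bar>- z * (J z * K z) / (N * w)\<bar> \<le> H z * (z / (N * w ^ 3))"
      by (simp add: mult.commute)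
  qed
  have "H x * exp (\<psi> x) \<le> H y * exp (\<psi> y)"
  proof (rule DERIV_nonneg_imp_nondecreasing[OF assms(2)])
    fix z assume "x \<le> z" "z \<le> y"
    then obtain d d' where d: "(H has_real_derivative d) (at z)" "(\<psi> has_real_derivative d') (at z)" "\<bar>d\<bar> \<le> H z * d'"
      using * by blast
    then have "((\<lambda>z. H z * exp (\<psi> z)) has_real_derivative exp (\<psi> z) * (d + H z * d')) (at z)"
      by (auto intro!: derivative_eq_intros simp: algebra_simps)
    then show "\<exists>D. ((\<lambda>z. H z * exp (\<psi> z)) has_real_derivative D) (at z) \<and> 0 \<le> D"
      using d(3) by (intro exI conjI) auto
  qed
  then show "H x * exp (1 / (N * sqrt (1 - x\<^sup>2))) \<le> H y * exp (1 / (N * sqrt (1 - y\<^sup>2)))"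
    by (simp add: \<psi>_def)
  have "H y * exp (- \<psi> y) \<le> H x * exp (- \<psi> x)"
  proof (rule DERIV_nonpos_imp_nonincreasing[OF assms(2)])
    fix z assume "x \<le> z" "z \<le> y"
    then obtain d d' where d: "(H has_real_derivative d) (at z)" "(\<psi> has_real_derivative d') (at z)" "\<bar>d\<bar> \<le> H z * d'"
      using * by blast
    then have "((\<lambda>z. H z * exp (- \<psi> z)) has_real_derivative exp (- \<psi> z) * (d - H z * d')) (at z)"
      by (auto intro!: derivative_eq_intros simp: algebra_simps)
    then show "\<exists>D. ((\<lambda>z. H z * exp (- \<psi> z)) has_real_derivative D) (at z) \<and> D \<le> 0"
      using d(3) by (intro exI conjI) (auto simp: mult_le_0_iff)
  qed
  then show "H y * exp (- (1 / (N * sqrt (1 - y\<^sup>2)))) \<le> H x * exp (- (1 / (N * sqrt (1 - x\<^sup>2))))"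
    by (simp add: \<psi>_def)
qed

section \<open>Two-sided bounds for the weighted energy\<close>

lemma weighted_G_bounds_nonneg:
  assumes "0 \<le> x" "x < 1"
  shows "sqrt (1 - x\<^sup>2) * G x \<le> 36 / N"
    and "x \<le> 1 - 1 / (4 * N\<^sup>2) \<Longrightarrow> sqrt (1 - x\<^sup>2) * G x \<ge> 1 / (36 * N)"
proof -
  have N: "N > 0" using N_ge_1 by simp
  have "sqrt (1 - x\<^sup>2) * G x \<le> 36 / N \<and>
      (x \<le> 1 - 1 / (4 * N\<^sup>2) \<longrightarrow> sqrt (1 - x\<^sup>2) * G x \<ge> 1 / (36 * N))"
  proof (cases "N * sqrt (1 - x\<^sup>2) \<le> 1")
    case True
    have "4 / N \<le> 36 / N" "1 / (36 * N) \<le> 1 / (4 * N)"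
      using N by (simp_all add: field_simps)
    then show ?thesis
      using weighted_G_le_near_1[OF assms True] weighted_G_ge_near_1[OF assms(1) _ True] by auto
  next
    case False
    \<comment> \<open>The edge of the boundary layer, where
      \<open>N * sqrt (1 - y\<^sup>2) = 1\<close>: both the estimates inside the layer and those for
      \<open>H\<close> apply at \<open>y\<close>.\<close>
    define y where "y = sqrt (1 - 1 / N\<^sup>2)"
    have N2: "1 / N\<^sup>2 \<le> 1" "1 / N\<^sup>2 > 0" using N_ge_1 by (simp_all add: divide_le_eq)
    have y: "0 \<le> y" "y < 1" "y\<^sup>2 = 1 - 1 / N\<^sup>2"
      using N2 by (simp_all add: y_def real_sqrt_lt_1_iff)
    have wy: "sqrt (1 - y\<^sup>2) = 1 / N"
      using N by (simp add: y real_sqrt_divide)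
    have "1 / N < sqrt (1 - x\<^sup>2)"
      using False N by (simp add: field_simps)
    then have "x\<^sup>2 \<le> y\<^sup>2"
      unfolding wy[symmetric] by simp
    then have xy: "x \<le> y" using y(1) by (rule power2_le_imp_le)
    have "1 - y \<ge> 1 / (4 * N\<^sup>2)"
    proof -
      have "1 / N\<^sup>2 = (1 + y) * (1 - y)" using y(3) by (simp add: algebra_simps power2_eq_square)
      also have "\<dots> \<le> 4 * (1 - y)" using y by (intro mult_right_mono) auto
      finally have "1 / N\<^sup>2 \<le> 4 * (1 - y)" .
      then show ?thesis using N by (simp add: field_simps)
    qed
    then have Gy: "1 / (4 * N) \<le> sqrt (1 - y\<^sup>2) * G y" "sqrt (1 - y\<^sup>2) * G y \<le> 4 / N"
      using weighted_G_ge_near_1[of y] weighted_G_le_near_1[of y] y(1,2) wy N by auto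
    have Hy: "sqrt (1 - y\<^sup>2) * G y \<le> 2 * H y" "2 * H y \<le> 3 * (sqrt (1 - y\<^sup>2) * G y)"
      using H_bounds[of y] y(1,2) wy N by auto
    have Hx: "sqrt (1 - x\<^sup>2) * G x \<le> 2 * H x" "2 * H x \<le> 3 * (sqrt (1 - x\<^sup>2) * G x)"
      using H_bounds[of x] assms False by auto
    have Hpos: "H x \<ge> 0" "H y \<ge> 0"
    proof -
      have "0 \<le> sqrt (1 - z\<^sup>2) * G z" if "0 \<le> z" "z < 1" for z
        using that G_nonneg[of z] by (simp add: abs_square_le_1)
      from this[of x] this[of y] show "H x \<ge> 0" "H y \<ge> 0"
        using assms y(1,2) Hx Hy by auto
    qed
    define e where "e = 1 / (N * sqrt (1 - x\<^sup>2))"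
    have e: "0 \<le> e" "N * sqrt (1 - y\<^sup>2) = 1" using N wy assms by (auto simp: e_def abs_square_le_1)
    have "H x \<le> H x * exp e"
      using e Hpos by (simp add: mult_le_cancel_left1)
    also have "\<dots> \<le> H y * exp 1"
      using H_exp_mono(1)[OF assms(1) xy y(2)] e by (simp add: e_def)
    also have "\<dots> \<le> H y * 3"
      using Hpos exp_le by (intro mult_left_mono) auto
    finally have 1: "H x \<le> 3 * H y" by simp
    have "H y \<le> H y * (3 * exp (-1))"
      using mult_right_mono[OF exp_le Hpos(2)] by (simp add: exp_minus field_simps)
    also have "\<dots> = 3 * (H y * exp (-1))" by simp
    also have "\<dots> \<le> 3 * (H x * exp (- e))"
      using H_exp_mono(2)[OF assms(1) xy y(2)] e by (simp add: e_def)
    also have "\<dots> \<le> 3 * H x"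
      using Hpos e by (simp add: mult_le_cancel_left2)
    finally have 2: "H y \<le> 3 * H x" .
    \<comment> \<open>One factor \<open>3\<close> bounds \<open>exp 1\<close>, the other is the
      ratio of the two constants in \<open>H_bounds\<close>.\<close>
    have "sqrt (1 - x\<^sup>2) * G x \<le> 9 * (sqrt (1 - y\<^sup>2) * G y)"
         "sqrt (1 - y\<^sup>2) * G y \<le> 9 * (sqrt (1 - x\<^sup>2) * G x)"
      using 1 2 Hx Hy by linarith+
    moreover have "9 * (4 / N) = 36 / N" "1 / (4 * N) = 9 * (1 / (36 * N))" by simp_all
    ultimately show ?thesis using Gy by linarith
  qed
  then show "sqrt (1 - x\<^sup>2) * G x \<le> 36 / N"
    and "x \<le> 1 - 1 / (4 * N\<^sup>2) \<Longrightarrow> sqrt (1 - x\<^sup>2) * G x \<ge> 1 / (36 * N)"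
    by auto
qed

text \<open>The left half follows by reflection. The lower bound has to stop short of the end
  points, where the weight vanishes while \<open>G\<close> is \<open>2\<close>.\<close>

lemma weighted_G_bounds:
  assumes "\<bar>x\<bar> < 1"
  shows "sqrt (1 - x\<^sup>2) * G x \<le> 36 / N"
    and "\<bar>x\<bar> \<le> 1 - 1 / (4 * N\<^sup>2) \<Longrightarrow> sqrt (1 - x\<^sup>2) * G x \<ge> 1 / (36 * N)"
proof -
  interpret mirror: jacobi_pair "\<lambda>x. K (- x)" "\<lambda>x. J (- x)" "\<lambda>x. - K' (- x)" "\<lambda>x. - J' (- x)" N
    by (rule mirror)
  have G: "mirror.G x = G (- x)" for x
    by (simp add: G_def mirror.G_def)
  show "sqrt (1 - x\<^sup>2) * G x \<le> 36 / N"
    and "\<bar>x\<bar> \<le> 1 - 1 / (4 * N\<^sup>2) \<Longrightarrow> sqrt (1 - x\<^sup>2) * G x \<ge> 1 / (36 * N)"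
    using weighted_G_bounds_nonneg[of x] mirror.weighted_G_bounds_nonneg[of "- x"] assms
    by (cases "x \<ge> 0"; simp add: G)+
qed

text \<open>To the left of \<open>- 1\<close> the second summand of \<open>G\<close> is nonpositive,
  but \<open>(1 - x) * G x\<close> is antitone on the whole line and equals \<open>4\<close> at
  \<open>- 1\<close>.\<close>

lemma G_nonneg_left:
  assumes "x \<le> - 1" shows "G x \<ge> 0"
  using G_minus_antimono[OF assms] assms by (simp add: G_minus_1) (smt (verit) mult_pos_neg)

end

subsection \<open>Jacobi polynomials\<close>

text \<open>Linear factors are split off one by one. As the degree is only bounded from above,
  \<open>c\<close> may be \<open>0\<close>.\<close>

lemma poly_eq_smult_prod_roots:
  fixes p :: "'a::idom poly"
  assumes "finite A" "degree p \<le> card A" "\<And>a. a \<in> A \<Longrightarrow> poly p a = 0"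
  shows "\<exists>c. p = smult c (\<Prod>a\<in>A. [:- a, 1:])"
  using assms
proof (induction A arbitrary: p rule: finite_induct)
  case empty
  then show ?case by (auto elim: degree_eq_zeroE)
next
  case (insert a A)
  have "[:- a, 1:] dvd p"
    using insert.prems(2)[of a] by (simp add: poly_eq_0_iff_dvd)
  then obtain q where q: "p = [:- a, 1:] * q"
    by (rule dvdE)
  have "degree q \<le> card A"
  proof (cases "q = 0")
    case False
    then have "degree p = Suc (degree q)" by (simp add: q degree_mult_eq del: mult_pCons_left)
    then show ?thesis using insert by simp
  qed simp
  moreover have "poly q b = 0" if "b \<in> A" for b
    using insert.prems(2)[of b] insert.hyps(2) that by (auto simp: q)
  ultimately obtain c where "q = smult c (\<Prod>a\<in>A. [:- a, 1:])"
    using insert.IH by blast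
  then show ?case
    using insert.hyps by (auto simp: q)
qed

text \<open>Reflection swaps the two linear factors up to sign; reversing the summation order then
  exchanges the parameters.\<close>

lemma jacobiP_minus: "jacobiP n \<alpha> \<beta> (- x) = (- 1) ^ n * jacobiP n \<beta> \<alpha> x"
proof -
  have "jacobiP n \<alpha> \<beta> (- x) =
      (\<Sum>s\<le>n. (- 1) ^ n * (((real n + \<alpha>) gchoose (n - s)) * ((real n + \<beta>) gchoose s)
               * ((x + 1) / 2) ^ s * ((x - 1) / 2) ^ (n - s)))"
    unfolding jacobiP_def
  proof (intro sum.cong refl)
    fix s assume "s \<in> {..n}"
    then have s: "(- 1::real) ^ n = (- 1) ^ s * (- 1) ^ (n - s)"
      by (simp flip: power_add)
    have "(- x - 1) / 2 = (- 1) * ((x + 1) / 2)" "(- x + 1) / 2 = (- 1) * ((x - 1) / 2)"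
      by simp_all
    then show "((real n + \<alpha>) gchoose (n - s)) * ((real n + \<beta>) gchoose s) * ((- x - 1) / 2) ^ s * ((- x + 1) / 2) ^ (n - s) =
       (- 1) ^ n * (((real n + \<alpha>) gchoose (n - s)) * ((real n + \<beta>) gchoose s) * ((x + 1) / 2) ^ s * ((x - 1) / 2) ^ (n - s))"
      unfolding s by (simp only: power_mult_distrib mult_ac)
  qed
  also have "\<dots> = (\<Sum>s\<le>n. (- 1) ^ n * (((real n + \<beta>) gchoose (n - s)) * ((real n + \<alpha>) gchoose s)
               * ((x - 1) / 2) ^ s * ((x + 1) / 2) ^ (n - s)))"
    by (rule sum.reindex_bij_witness[of _ "\<lambda>s. n - s" "\<lambda>s. n - s"]) (auto simp: mult_ac)
  finally show ?thesis
    by (simp add: jacobiP_def sum_distrib_left)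
qed

lemma jacobiP_is_poly: "\<exists>p. degree p \<le> n \<and> jacobiP n \<alpha> \<beta> = poly p"
proof (intro exI conjI)
  let ?p = "\<Sum>s\<le>n. smult (((real n + \<alpha>) gchoose (n - s)) * ((real n + \<beta>) gchoose s))
               ([:- 1 / 2, 1 / 2:] ^ s * [:1 / 2, 1 / 2:] ^ (n - s))"
  show "degree ?p \<le> n"
  proof (rule degree_sum_le)
    fix s assume s: "s \<in> {..n}"
    have "degree ([:- 1 / 2, 1 / 2:] ^ s * [:1 / 2, 1 / 2 :: real:] ^ (n - s)) \<le> 1 * s + 1 * (n - s)"
      by (intro order_trans[OF degree_mult_le] add_mono order_trans[OF degree_power_le]) auto
    then show "degree (smult (((real n + \<alpha>) gchoose (n - s)) * ((real n + \<beta>) gchoose s))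
               ([:- 1 / 2, 1 / 2:] ^ s * [:1 / 2, 1 / 2:] ^ (n - s))) \<le> n"
      using s by (intro order_trans[OF degree_smult_le]) simp
  qed simp
  show "jacobiP n \<alpha> \<beta> = poly ?p"
    by (auto simp: jacobiP_def poly_sum fun_eq_iff field_simps intro!: sum.cong)
qed

section \<open>Differential relations between \<open>P_n^(1,0)\<close> and
  \<open>P_n^(0,1)\<close>\<close>

lemma jacobiP_1_0: "jacobiP n 1 0 x =
    (\<Sum>s\<le>n. real (Suc n choose Suc s) * real (n choose s) * ((x - 1) / 2) ^ s * ((x + 1) / 2) ^ (n - s))"
  unfolding jacobiP_def
proof (intro sum.cong refl)
  fix s assume "s \<in> {..n}"
  then have "Suc n choose (n - s) = Suc n choose Suc s"
    by (subst binomial_symmetric) auto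
  moreover have "(real n + 1) gchoose (n - s) = real (Suc n choose (n - s))"
    by (simp add: binomial_gbinomial add.commute del: binomial_Suc_Suc)
  moreover have "(real n + 0) gchoose s = real (n choose s)"
    by (simp add: binomial_gbinomial)
  ultimately show "((real n + 1) gchoose (n - s)) * ((real n + 0) gchoose s) * ((x - 1) / 2) ^ s * ((x + 1) / 2) ^ (n - s) =
      real (Suc n choose Suc s) * real (n choose s) * ((x - 1) / 2) ^ s * ((x + 1) / 2) ^ (n - s)"
    by (simp only:)
qed

lemma jacobiP_0_1: "jacobiP n 0 1 x =
    (\<Sum>s\<le>n. real (n choose s) * real (Suc n choose s) * ((x - 1) / 2) ^ s * ((x + 1) / 2) ^ (n - s))"
  unfolding jacobiP_def
proof (intro sum.cong refl)
  fix s assume "s \<in> {..n}"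
  then have "n choose (n - s) = n choose s"
    by (subst binomial_symmetric) auto
  moreover have "(real n + 1) gchoose s = real (Suc n choose s)"
    by (simp add: binomial_gbinomial add.commute del: binomial_Suc_Suc)
  moreover have "(real n + 0) gchoose (n - s) = real (n choose (n - s))"
    by (simp add: binomial_gbinomial)
  ultimately show "((real n + 0) gchoose (n - s)) * ((real n + 1) gchoose s) * ((x - 1) / 2) ^ s * ((x + 1) / 2) ^ (n - s) =
      real (n choose s) * real (Suc n choose s) * ((x - 1) / 2) ^ s * ((x + 1) / 2) ^ (n - s)"
    by (simp only:)
qed

lemma jacobiP_0_1_at_1: "jacobiP n 0 1 1 = 1"
proof -
  have "jacobiP n 0 1 1 = (\<Sum>s\<le>n. if s = 0 then 1 else 0)"
    unfolding jacobiP_0_1 by (intro sum.cong) auto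
  then show ?thesis by simp
qed

text \<open>Coefficient comparison for the derivative below: absorption extracts the common factor
  \<open>Suc n * (n choose s)\<close>, and Pascal's rule joins the rest.\<close>

lemma binomial_coeff_recurrence:
  "Suc s * (Suc n choose Suc s) * (n choose s) + (if s = 0 then 0 else (Suc n - s) * (Suc n choose s) * (n choose (s - 1)))
    = Suc n * ((n choose s) * (Suc n choose s))"
proof (cases s)
  case (Suc m)
  have 1: "Suc s * (Suc n choose Suc s) = Suc n * (n choose s)"
    using Suc_times_binomial_eq[of n s] by (simp add: mult.commute)
  have 2: "(Suc n - s) * (Suc n choose s) = Suc n * (n choose s)"
    using binomial_absorb_comp[of "Suc n" s] by simp
  show ?thesis
    unfolding 1 2 using Suc by (simp add: algebra_simps)
qed simp

text \<open>With \<open>u = (x - 1) / 2\<close> the factor \<open>1 - x\<close> is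
  \<open>- 2 * u\<close>, so it only raises the power of \<open>u\<close> in each term;
  differentiating gives two sums whose coefficients match after an index shift.\<close>

lemma DERIV_jacobiP_1_0:
  "((\<lambda>x. (1 - x) * jacobiP n 1 0 x) has_real_derivative - (real n + 1) * jacobiP n 0 1 x) (at x)"
proof -
  define c where "c s = real (Suc n choose Suc s) * real (n choose s)" for s
  define d where "d s = (if s = 0 then 0 else real (Suc n - s) * c (s - 1))" for s
  define u v where "u = (x - 1) / 2" and "v = (x + 1) / 2"
  have *: "(\<lambda>x. (1 - x) * jacobiP n 1 0 x) =
      (\<lambda>x. - 2 * (\<Sum>s\<le>n. c s * ((x - 1) / 2) ^ Suc s * ((x + 1) / 2) ^ (n - s)))"
    unfolding jacobiP_1_0 c_def sum_distrib_left by (intro ext sum.cong refl) (simp add: field_simps)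
  have "((\<lambda>x. (1 - x) * jacobiP n 1 0 x) has_real_derivative
      - 2 * (\<Sum>s\<le>n. c s * ((real (Suc s) * u ^ s / 2) * v ^ (n - s)
            + u ^ Suc s * (real (n - s) * v ^ (n - s - 1) / 2)))) (at x)"
    unfolding * u_def v_def
  proof (intro DERIV_cmult DERIV_sum)
    fix s
    have U: "((\<lambda>x::real. (x - 1) / 2) has_real_derivative 1 / 2) (at x)"
      and V: "((\<lambda>x::real. (x + 1) / 2) has_real_derivative 1 / 2) (at x)"
      by (auto intro!: derivative_eq_intros)
    show "((\<lambda>x. c s * ((x - 1) / 2) ^ Suc s * ((x + 1) / 2) ^ (n - s)) has_real_derivative
      c s * ((real (Suc s) * ((x - 1) / 2) ^ s / 2) * ((x + 1) / 2) ^ (n - s)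
            + ((x - 1) / 2) ^ Suc s * (real (n - s) * ((x + 1) / 2) ^ (n - s - 1) / 2))) (at x)"
      using DERIV_cmult[OF DERIV_mult[OF DERIV_power[OF U, of "Suc s"] DERIV_power[OF V, of "n - s"]], of "c s"]
      by (simp add: algebra_simps)
  qed
  also have "- 2 * (\<Sum>s\<le>n. c s * ((real (Suc s) * u ^ s / 2) * v ^ (n - s)
            + u ^ Suc s * (real (n - s) * v ^ (n - s - 1) / 2))) =
      - ((\<Sum>s\<le>n. real (Suc s) * c s * u ^ s * v ^ (n - s))
          + (\<Sum>s\<le>n. real (n - s) * c s * u ^ Suc s * v ^ (n - Suc s)))"
    unfolding sum_distrib_left sum.distrib[symmetric] sum_negf[symmetric]
    by (intro sum.cong refl) (simp add: field_simps)
  \<comment> \<open>The term \<open>s = n\<close> vanishes because of the factor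
    \<open>n - s\<close>; after the shift, \<open>d 0 = 0\<close> supplies the missing term at the
    other end.\<close>
  also have "(\<Sum>s\<le>n. real (n - s) * c s * u ^ Suc s * v ^ (n - Suc s))
      = (\<Sum>s<n. d (Suc s) * u ^ Suc s * v ^ (n - Suc s))"
    by (simp add: d_def lessThan_Suc_atMost[symmetric] del: power_Suc)
  also have "\<dots> = (\<Sum>s\<le>n. d s * u ^ s * v ^ (n - s))"
    by (simp add: sum.atMost_shift d_def)
  also have "(\<Sum>s\<le>n. real (Suc s) * c s * u ^ s * v ^ (n - s)) + \<dots>
      = (\<Sum>s\<le>n. (real n + 1) * (real (n choose s) * real (Suc n choose s) * u ^ s * v ^ (n - s)))"
    unfolding sum.distrib[symmetric]
  proof (intro sum.cong refl)
    fix s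
    have "real (Suc s) * c s + d s = (real n + 1) * (real (n choose s) * real (Suc n choose s))"
      using arg_cong[OF binomial_coeff_recurrence[of s n], of real]
      unfolding c_def d_def of_nat_add of_nat_mult
      by (cases s) (simp_all add: ring_distribs mult_ac add_ac del: binomial_Suc_Suc)
    then show "real (Suc s) * c s * u ^ s * v ^ (n - s) + d s * u ^ s * v ^ (n - s)
        = (real n + 1) * (real (n choose s) * real (Suc n choose s) * u ^ s * v ^ (n - s))"
      by (metis (no_types, lifting) distrib_right mult.assoc)
  qed
  also have "\<dots> = (real n + 1) * jacobiP n 0 1 x"
    by (simp add: jacobiP_0_1 sum_distrib_left u_def v_def)
  finally show ?thesis by (simp only: mult_minus_left)
qed

lemma DERIV_jacobiP_0_1:
  "((\<lambda>x. (1 + x) * jacobiP n 0 1 x) has_real_derivative (real n + 1) * jacobiP n 1 0 x) (at x)"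
proof -
  have "((\<lambda>x. (1 - (- x)) * jacobiP n 1 0 (- x)) has_real_derivative
      - (- (real n + 1) * jacobiP n 0 1 (- x))) (at x)"
    using DERIV_jacobiP_1_0[of n "- x"] by (simp only: DERIV_mirror)
  then have "((\<lambda>x. (- 1) ^ n * ((1 - (- x)) * jacobiP n 1 0 (- x))) has_real_derivative
      (- 1) ^ n * - (- (real n + 1) * jacobiP n 0 1 (- x))) (at x)"
    by (rule DERIV_cmult)
  moreover have "(- 1) ^ n * ((- 1) ^ n * y) = y" for y :: real
    by (simp flip: mult.assoc power_mult_distrib)
  ultimately show ?thesis
    by (simp add: jacobiP_minus algebra_simps)
qed

lemma DERIV_jacobiP: "(jacobiP n \<alpha> \<beta> has_real_derivative deriv (jacobiP n \<alpha> \<beta>) x) (at x)"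
proof -
  obtain p where "jacobiP n \<alpha> \<beta> = poly p"
    using jacobiP_is_poly by blast
  then show ?thesis
    by (metis poly_DERIV DERIV_imp_deriv)
qed

lemma jacobi_pair_jacobiP:
  "jacobi_pair (jacobiP n 1 0) (jacobiP n 0 1) (deriv (jacobiP n 1 0)) (deriv (jacobiP n 0 1)) (real n + 1)"
proof
  fix x
  show "(jacobiP n 1 0 has_real_derivative deriv (jacobiP n 1 0) x) (at x)"
    and "(jacobiP n 0 1 has_real_derivative deriv (jacobiP n 0 1) x) (at x)"
    by (rule DERIV_jacobiP)+
  have "((\<lambda>x. (1 - x) * jacobiP n 1 0 x) has_real_derivative
      (1 - x) * deriv (jacobiP n 1 0) x - jacobiP n 1 0 x) (at x)"
    by (rule derivative_eq_intros DERIV_jacobiP refl)+ simp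
  from DERIV_unique[OF this DERIV_jacobiP_1_0]
  show "(1 - x) * deriv (jacobiP n 1 0) x = jacobiP n 1 0 x - (real n + 1) * jacobiP n 0 1 x"
    by (simp add: algebra_simps)
  have "((\<lambda>x. (1 + x) * jacobiP n 0 1 x) has_real_derivative
      (1 + x) * deriv (jacobiP n 0 1) x + jacobiP n 0 1 x) (at x)"
    by (rule derivative_eq_intros DERIV_jacobiP refl)+ simp
  from DERIV_unique[OF this DERIV_jacobiP_0_1]
  show "(1 + x) * deriv (jacobiP n 0 1) x = (real n + 1) * jacobiP n 1 0 x - jacobiP n 0 1 x"
    by (simp add: algebra_simps)
qed (simp_all add: jacobiP_minus jacobiP_0_1_at_1 flip: power_mult)

section \<open>Products of linear factors and an elementary sum\<close>

lemma DERIV_prod_linear: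
  fixes t :: "'a \<Rightarrow> real"
  assumes "finite A" "x \<notin> t ` A"
  shows "((\<lambda>x. \<Prod>i\<in>A. (x - t i)) has_real_derivative (\<Prod>i\<in>A. (x - t i)) * (\<Sum>i\<in>A. 1 / (x - t i))) (at x)"
  using assms
proof (induction A rule: finite_induct)
  case (insert a A)
  then have "x - t a \<noteq> 0" by auto
  have "((\<lambda>x. (x - t a) * (\<Prod>i\<in>A. (x - t i))) has_real_derivative
      1 * (\<Prod>i\<in>A. (x - t i)) + ((\<Prod>i\<in>A. (x - t i)) * (\<Sum>i\<in>A. 1 / (x - t i))) * (x - t a)) (at x)"
    using insert by (intro DERIV_mult) (auto intro!: derivative_eq_intros)
  then show ?case
    using insert.hyps \<open>x - t a \<noteq> 0\<close> by (simp add: distrib_left mult_ac)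
qed simp

lemma DERIV_prod_linear_root:
  fixes t :: "'a \<Rightarrow> real"
  assumes "finite A" "a \<in> A"
  shows "((\<lambda>x. \<Prod>i\<in>A. (x - t i)) has_real_derivative (\<Prod>i\<in>A - {a}. (t a - t i))) (at (t a))"
proof -
  have "((\<lambda>x. \<Prod>i\<in>A - {a}. (x - t i)) has_real_derivative
      (\<Sum>i\<in>A - {a}. 1 * (\<Prod>j\<in>A - {a} - {i}. (t a - t j)))) (at (t a))"
    by (rule has_field_derivative_prod) (auto intro!: derivative_eq_intros)
  then obtain D where "((\<lambda>x. \<Prod>i\<in>A - {a}. (x - t i)) has_real_derivative D) (at (t a))"
    by blast
  then have "((\<lambda>x. (x - t a) * (\<Prod>i\<in>A - {a}. (x - t i))) has_real_derivative
      1 * (\<Prod>i\<in>A - {a}. (t a - t i)) + D * (t a - t a)) (at (t a))"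
    by (intro DERIV_mult) (auto intro!: derivative_eq_intros)
  then show ?thesis
    using assms by (simp add: prod.remove)
qed

text \<open>Telescoping: each summand is at most
  \<open>2 * (sqrt (real i) - sqrt (real i - 1))\<close>.\<close>

lemma sum_inverse_sqrt_le: "(\<Sum>i=1..n. 1 / sqrt (real i)) \<le> 2 * sqrt (real n)"
proof (induction n)
  case (Suc n)
  define a b where "a = sqrt (real n)" and "b = sqrt (real (Suc n))"
  have ab: "0 \<le> a" "a \<le> b" "0 < b" "(b - a) * (b + a) = 1"
    by (simp_all add: a_def b_def algebra_simps)
  have "(b - a) * (b + a) \<le> (b - a) * (2 * b)"
    using ab(1-3) by (intro mult_left_mono) auto
  then have "1 \<le> (2 * b - 2 * a) * b"
    unfolding ab(4) by (simp add: algebra_simps)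
  then have "1 / b \<le> 2 * b - 2 * a"
    using ab(3) by (simp add: pos_divide_le_eq)
  then show ?case
    using Suc by (simp add: a_def b_def)
qed simp

subsection \<open>Interpolation at the Radau points\<close>

locale radau =
  fixes N :: nat and t :: "nat \<Rightarrow> real"
  assumes N_ge_2: "N \<ge> 2"
    and zeros: "i \<in> {1..<N} \<Longrightarrow> -1 < t i \<and> t i < 1 \<and> jacobiP (N - 1) 1 0 (t i) = 0"
    and step: "1 \<le> i \<Longrightarrow> Suc i < N \<Longrightarrow> t i < t (Suc i)"
    and t_N: "t N = 1"
begin

definition J :: "real \<Rightarrow> real" where "J = jacobiP (N - 1) 1 0"
definition K :: "real \<Rightarrow> real" where "K = jacobiP (N - 1) 0 1"

sublocale jacobi_pair J K "deriv J" "deriv K" "real N"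
  using jacobi_pair_jacobiP[of "N - 1"] N_ge_2 by (simp add: J_def K_def of_nat_diff)

lemma node_interior: "i \<in> {1..<N} \<Longrightarrow> -1 < t i \<and> t i < 1 \<and> J (t i) = 0"
  using zeros[of i] by (simp add: J_def)

lemma N_pos: "real N > 0"
  using N_ge_2 by simp

lemma t_less:
  assumes "1 \<le> i" "i < j" "j \<le> N" shows "t i < t j"
proof -
  have "j < N \<Longrightarrow> t i < t j"
    using assms(2)
  proof (induction j)
    case (Suc j)
    then show ?case
      using step[of j] assms(1) by (cases "i = j") auto
  qed simp
  moreover have "t i < t N"
    using node_interior[of i] assms by (auto simp: t_N)
  ultimately show ?thesis
    using assms by (cases "j = N") auto
qed

lemma inj_t: "inj_on t {1..N}"
proof (rule inj_onI)
  fix i j assume "i \<in> {1..N}" "j \<in> {1..N}" "t i = t j"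
  then show "i = j"
    using t_less[of i j] t_less[of j i] by (cases i j rule: linorder_cases) auto
qed

lemma t_bounds: "i \<in> {1..N} \<Longrightarrow> - 1 < t i \<and> t i \<le> 1"
  using node_interior[of i] t_N by (cases "i = N") (auto intro: less_imp_le)

lemma atLeastAtMost_N: "{1..N} = insert N {1..<N}"
  using N_ge_2 by auto

section \<open>The node polynomial and the Lagrange polynomials\<close>

lemma J_prod: "\<exists>c. c \<noteq> 0 \<and> (\<forall>x. J x = c * (\<Prod>i=1..<N. (x - t i)))"
proof -
  obtain p where p: "degree p \<le> N - 1" "J = poly p"
    unfolding J_def using jacobiP_is_poly by blast
  have inj: "inj_on t {1..<N}"
    using inj_t by (rule inj_on_subset) auto
  have "degree p \<le> card (t ` {1..<N})"
    using p(1) card_image[OF inj] by simp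
  moreover have "poly p a = 0" if "a \<in> t ` {1..<N}" for a
    using that node_interior by (auto simp flip: p(2))
  ultimately obtain c where "p = smult c (\<Prod>a\<in>t ` {1..<N}. [:- a, 1:])"
    using poly_eq_smult_prod_roots[of "t ` {1..<N}" p] by blast
  then have c: "J x = c * (\<Prod>i=1..<N. (x - t i))" for x
    using inj by (simp add: p(2) prod.reindex poly_prod)
  \<comment> \<open>\<open>J\<close> is not the zero polynomial, since its value at
    \<open>- 1\<close> has square \<open>1\<close>.\<close>
  moreover have "c \<noteq> 0"
    using c[of "-1"] J_minus_1 by auto
  ultimately show ?thesis by blast
qed

lemma omega_prod: "\<exists>c. c \<noteq> 0 \<and> (\<forall>x. (1 - x) * J x = c * (\<Prod>i=1..N. (x - t i)))"
proof -
  obtain c where c: "c \<noteq> 0" "\<And>x. J x = c * (\<Prod>i=1..<N. (x - t i))"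
    using J_prod by blast
  have "(1 - x) * J x = - c * (\<Prod>i=1..N. (x - t i))" for x
    using N_ge_2 unfolding c(2) atLeastAtMost_N by (simp add: t_N algebra_simps)
  then show ?thesis
    using c(1) by (intro exI[of _ "- c"]) auto
qed

lemma DERIV_omega: "((\<lambda>x. (1 - x) * J x) has_real_derivative - real N * K x) (at x)"
  using DERIV_jacobiP_1_0[of "N - 1" x] N_ge_2 by (simp add: J_def K_def of_nat_diff)

lemma omega_nonzero:
  assumes "x \<notin> t ` {1..N}" shows "(1 - x) * J x \<noteq> 0"
proof -
  obtain c where "c \<noteq> 0" "(1 - x) * J x = c * (\<Prod>i=1..N. (x - t i))"
    using omega_prod by blast
  then show ?thesis
    using assms by auto
qed

text \<open>The logarithmic derivative of the node polynomial, cleared of its denominator.\<close>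

lemma sum_inverse_eq:
  assumes "x \<notin> t ` {1..N}"
  shows "(1 - x) * J x * (\<Sum>i=1..N. 1 / (x - t i)) = - real N * K x"
proof -
  obtain c where c: "\<And>x. (1 - x) * J x = c * (\<Prod>i=1..N. (x - t i))"
    using omega_prod by blast
  have "((\<lambda>x. (1 - x) * J x) has_real_derivative
      c * ((\<Prod>i=1..N. (x - t i)) * (\<Sum>i=1..N. 1 / (x - t i)))) (at x)"
    unfolding c using assms by (intro DERIV_cmult DERIV_prod_linear) auto
  from DERIV_unique[OF this DERIV_omega] show ?thesis
    unfolding c by (simp add: mult.assoc)
qed

text \<open>The classical formula \<open>R_i(x) = \<omega>(x) / (\<omega>'(t_i) (x - t_i))\<close>
  with \<open>\<omega>' = - N K\<close>, multiplied out so that it also holds at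
  \<open>x = t i\<close>.\<close>

lemma
  assumes "i \<in> {1..N}"
  shows K_nonzero: "K (t i) \<noteq> 0"
    and lagrange_basis_eq: "lagrange_basis N t i x * (real N * K (t i)) * (t i - x) = (1 - x) * J x"
proof -
  obtain c where c: "c \<noteq> 0" "\<And>x. (1 - x) * J x = c * (\<Prod>i=1..N. (x - t i))"
    using omega_prod by blast
  define P where "P = (\<Prod>j\<in>{1..N} - {i}. (t i - t j))"
  have "((\<lambda>x. (1 - x) * J x) has_real_derivative c * P) (at (t i))"
    unfolding c P_def using assms by (intro DERIV_cmult DERIV_prod_linear_root) auto
  from DERIV_unique[OF DERIV_omega this] have K: "- real N * K (t i) = c * P" .
  have "t i - t j \<noteq> 0" if "j \<in> {1..N} - {i}" for j
    using inj_onD[OF inj_t, of i j] assms that by auto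
  then have "P \<noteq> 0"
    unfolding P_def by (simp add: prod_zero_iff)
  then show "K (t i) \<noteq> 0"
    using K c(1) by auto
  have "lagrange_basis N t i x * (real N * K (t i)) * (t i - x)
      = lagrange_basis N t i x * (- real N * K (t i)) * (x - t i)"
    by (simp add: algebra_simps)
  also have "\<dots> = c * ((x - t i) * (\<Prod>j\<in>{1..N} - {i}. (x - t j)))"
    unfolding K using \<open>P \<noteq> 0\<close> by (simp add: lagrange_basis_def prod_dividef P_def)
  also have "\<dots> = (1 - x) * J x"
    using assms prod.remove[of "{1..N}" i "\<lambda>j. x - t j"] by (simp add: c(2))
  finally show "lagrange_basis N t i x * (real N * K (t i)) * (t i - x) = (1 - x) * J x" .
qed

lemma G_node: "i \<in> {1..N} \<Longrightarrow> G (t i) = (1 + t i) * (K (t i))\<^sup>2"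
  using node_interior[of i] t_N by (cases "i = N") (auto simp: G_def)

lemma G_node_pos: "i \<in> {1..N} \<Longrightarrow> G (t i) > 0"
  using t_bounds[of i] K_nonzero[of i] by (simp add: G_node)

section \<open>The quadratic identity for the Lagrange polynomials\<close>

lemma sum_weighted_inverse_sq:
  assumes "x \<notin> t ` {1..N}"
  shows "((1 - x) * J x)\<^sup>2 * (\<Sum>i=1..N. (1 + t i) / (x - t i)\<^sup>2) = (real N)\<^sup>2 * G x"
proof -
  define S where "S x = (\<Sum>i=1..N. 1 / (x - t i))" for x
  define Q \<omega> where "Q = (\<Sum>i=1..N. 1 / (x - t i)\<^sup>2)" and "\<omega> = (1 - x) * J x"
  have nz: "x - t i \<noteq> 0" if "i \<in> {1..N}" for i
    using assms that by auto
  have "(S has_real_derivative (\<Sum>i=1..N. - 1 / (x - t i)\<^sup>2)) (at x)"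
    unfolding S_def
    by (intro DERIV_sum) (use nz in \<open>auto intro!: derivative_eq_intros simp: power2_eq_square\<close>)
  then have S': "(S has_real_derivative - Q) (at x)"
    by (simp add: Q_def sum_negf)
  have "((\<lambda>x. (1 - x) * J x * S x) has_real_derivative - real N * K x * S x + - Q * ((1 - x) * J x)) (at x)"
    by (intro DERIV_mult DERIV_omega S')
  \<comment> \<open>A second evaluation of the same derivative: off the finite node set the product
    coincides with \<open>- N * K\<close>.\<close>
  moreover have "((\<lambda>x. (1 - x) * J x * S x) has_real_derivative - real N * deriv K x) (at x)"
  proof (rule has_field_derivative_transform_within_open[where S = "- t ` {1..N}"])
    show "((\<lambda>x. - real N * K x) has_real_derivative - real N * deriv K x) (at x)"
      by (intro DERIV_cmult DERIV_K)
    show "open (- t ` {1..N})"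
      by (intro open_Compl finite_imp_closed) auto
    show "- real N * K y = (1 - y) * J y * S y" if "y \<in> - t ` {1..N}" for y
      using sum_inverse_eq[of y] that by (simp add: S_def)
  qed (use assms in auto)
  ultimately have "- real N * K x * S x + - Q * ((1 - x) * J x) = - real N * deriv K x"
    by (rule DERIV_unique)
  then have Q: "\<omega> * Q = real N * deriv K x - real N * K x * S x"
    by (simp add: \<omega>_def algebra_simps)
  have S: "\<omega> * S x = - real N * K x"
    using sum_inverse_eq[OF assms] by (simp add: \<omega>_def S_def)
  \<comment> \<open>Writing \<open>1 + t i = (1 + x) - (x - t i)\<close> reduces the sum to
    \<open>Q\<close> and \<open>S x\<close>; the factor \<open>1 + x\<close> is what makes the
    equation for \<open>K\<close> applicable.\<close>
  have "(\<Sum>i=1..N. (1 + t i) / (x - t i)\<^sup>2) = (\<Sum>i=1..N. (1 + x) * (1 / (x - t i)\<^sup>2) - 1 / (x - t i))"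
  proof (intro sum.cong refl)
    fix i assume "i \<in> {1..N}"
    moreover define e where "e = x - t i"
    ultimately have e: "e \<noteq> 0" "t i = x - e"
      using nz by auto
    show "(1 + t i) / (x - t i)\<^sup>2 = (1 + x) * (1 / (x - t i)\<^sup>2) - 1 / (x - t i)"
      unfolding e(2) using e(1) by (simp add: field_simps power2_eq_square)
  qed
  also have "\<dots> = (1 + x) * Q - S x"
    by (simp add: Q_def S_def sum_subtractf sum_distrib_left)
  finally have *: "(\<Sum>i=1..N. (1 + t i) / (x - t i)\<^sup>2) = (1 + x) * Q - S x" .
  have "\<omega>\<^sup>2 * (\<Sum>i=1..N. (1 + t i) / (x - t i)\<^sup>2)
      = (1 + x) * \<omega> * (\<omega> * Q) - \<omega> * (\<omega> * S x)"
    unfolding * by (simp add: power2_eq_square algebra_simps)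
  also have "\<dots> = real N * \<omega> * ((1 + x) * deriv K x) - (1 + x) * real N * K x * (\<omega> * S x) - \<omega> * (\<omega> * S x)"
    unfolding Q by (simp add: algebra_simps)
  also have "\<dots> = (real N)\<^sup>2 * G x"
    unfolding S K_ode by (simp add: \<omega>_def G_def power2_eq_square algebra_simps)
  finally show ?thesis
    by (simp add: \<omega>_def)
qed

text \<open>Squaring the formula for \<open>R_i\<close> produces \<open>(K (t i))\<^sup>2\<close>,
  which \<open>G (t i) = (1 + t i) * (K (t i))\<^sup>2\<close> cancels, leaving the sum just
  evaluated.\<close>

lemma sum_lagrange_sq_G:
  assumes "x \<notin> t ` {1..N}"
  shows "(\<Sum>i=1..N. (lagrange_basis N t i x)\<^sup>2 * G (t i)) = G x"
proof -
  have "(real N)\<^sup>2 * (lagrange_basis N t i x)\<^sup>2 * G (t i) = ((1 - x) * J x)\<^sup>2 * ((1 + t i) / (x - t i)\<^sup>2)"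
    if i: "i \<in> {1..N}" for i
  proof -
    have "x - t i \<noteq> 0" using assms i by auto
    then show ?thesis
      unfolding lagrange_basis_eq[OF i, symmetric]
      by (simp add: G_node[OF i] power_mult_distrib power2_commute[of "t i" x])
  qed
  then have "(real N)\<^sup>2 * (\<Sum>i=1..N. (lagrange_basis N t i x)\<^sup>2 * G (t i)) = (real N)\<^sup>2 * G x"
    by (simp add: sum_distrib_left sum_weighted_inverse_sq[OF assms, symmetric] mult.assoc)
  then show ?thesis
    using N_pos by simp
qed

section \<open>Location of the nodes\<close>

lemma node_ge:
  assumes "i \<in> {1..<N}"
  shows "1 + t i \<ge> (real i)\<^sup>2 / (2 * (real N)\<^sup>2)"
proof -
  \<comment> \<open>\<open>x\<close> is the mirror image of \<open>t i\<close> in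
    \<open>- 1\<close>. The first \<open>i\<close> nodes lie within \<open>2 * d\<close> of it, so
    \<open>S\<close> is at least \<open>i / (2 * d)\<close>.\<close>
  define d x where "d = 1 + t i" and "x = - 1 - d"
  have d: "d > 0" using node_interior[OF assms] by (simp add: d_def)
  define S where "S = (\<Sum>j=1..N. 1 / (t j - x))"
  have pos: "t j - x > 0" if "j \<in> {1..N}" for j
    using t_bounds[OF that] d by (simp add: x_def)
  then have x: "x \<notin> t ` {1..N}" by fastforce
  have "real i * (1 / (2 * d)) = (\<Sum>j=1..i. 1 / (2 * d))" by simp
  also have "\<dots> \<le> (\<Sum>j=1..i. 1 / (t j - x))"
  proof (intro sum_mono)
    fix j assume j: "j \<in> {1..i}"
    then have "t j \<le> t i"
      using t_less[of j i] assms by (cases "j = i") (auto intro: less_imp_le)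
    then show "1 / (2 * d) \<le> 1 / (t j - x)"
      using pos[of j] j assms by (intro divide_left_mono mult_pos_pos) (auto simp: x_def d_def)
  qed
  also have "\<dots> \<le> S"
    unfolding S_def using pos assms by (intro sum_mono2) (auto intro: less_imp_le)
  finally have iS: "real i * (1 / (2 * d)) \<le> S" .
  have "(\<Sum>j=1..N. 1 / (x - t j)) = - S"
    unfolding S_def sum_negf[symmetric] by (intro sum.cong) (auto simp: minus_divide_right)
  then have eq: "(1 - x) * J x * S = real N * K x"
    using sum_inverse_eq[OF x] by simp
  \<comment> \<open>Since \<open>1 + x = - d\<close>, positivity of \<open>G\<close> bounds
    \<open>K\<close> by \<open>J\<close> here, and thereby bounds the logarithmic derivative
    \<open>S\<close> from above.\<close>
  have "0 \<le> (1 - x) * G x"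
    using G_nonneg_left[of x] d by (simp add: x_def)
  then have "(1 - x) * d * (K x)\<^sup>2 \<le> ((1 - x) * J x)\<^sup>2"
    by (simp add: G_def x_def power2_eq_square algebra_simps)
  moreover have "2 * d * (K x)\<^sup>2 \<le> (1 - x) * d * (K x)\<^sup>2"
    using d by (intro mult_right_mono) (auto simp: x_def)
  ultimately have K: "2 * d * (K x)\<^sup>2 \<le> ((1 - x) * J x)\<^sup>2" by simp
  have "2 * d * S\<^sup>2 * ((1 - x) * J x)\<^sup>2 = (real N)\<^sup>2 * (2 * d * (K x)\<^sup>2)"
  proof -
    have "((1 - x) * J x)\<^sup>2 * S\<^sup>2 = (real N)\<^sup>2 * (K x)\<^sup>2"
      using arg_cong[OF eq, of power2] by (simp only: power_mult_distrib)
    then have "2 * d * (((1 - x) * J x)\<^sup>2 * S\<^sup>2) = 2 * d * ((real N)\<^sup>2 * (K x)\<^sup>2)"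
      by (simp only:)
    then show ?thesis by (simp only: mult_ac)
  qed
  also have "\<dots> \<le> (real N)\<^sup>2 * ((1 - x) * J x)\<^sup>2"
    using K by (intro mult_left_mono) auto
  finally have "2 * d * S\<^sup>2 \<le> (real N)\<^sup>2"
    using omega_nonzero[OF x] by (simp add: mult_le_cancel_right)
  moreover have "2 * d * (real i * (1 / (2 * d)))\<^sup>2 \<le> 2 * d * S\<^sup>2"
    using iS d by (intro mult_left_mono power_mono) auto
  moreover have "2 * d * (real i * (1 / (2 * d)))\<^sup>2 = (real i)\<^sup>2 / (2 * d)"
    using d by (simp add: power2_eq_square field_simps)
  ultimately have "(real i)\<^sup>2 / (2 * d) \<le> (real N)\<^sup>2"
    by linarith
  then show ?thesis
    using d N_pos by (simp add: d_def field_simps)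
qed

text \<open>The sum is \<open>J' / J\<close> at \<open>1\<close>, where the equation for
  \<open>J\<close> degenerates. Differentiating \<open>(1 - x) * J' = J - N * K\<close> there gives
  \<open>2 * J' = N * K'\<close>, and the two equations at \<open>1\<close> express
  \<open>J 1\<close> and \<open>K'\<close> by \<open>K 1\<close>.\<close>

lemma sum_inverse_1_minus: "(\<Sum>i=1..<N. 1 / (1 - t i)) = ((real N)\<^sup>2 - 1) / 4"
proof -
  define S where "S x = (\<Sum>i=1..<N. 1 / (x - t i))" for x
  obtain c where c: "c \<noteq> 0" "\<And>x. J x = c * (\<Prod>i=1..<N. (x - t i))"
    using J_prod by blast
  have J': "deriv J x = J x * S x" if "x \<notin> t ` {1..<N}" for x
  proof -
    have "(J has_real_derivative c * ((\<Prod>i=1..<N. (x - t i)) * S x)) (at x)"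
      unfolding c(2)[abs_def] S_def using that by (intro DERIV_cmult DERIV_prod_linear) auto
    then show ?thesis
      using DERIV_unique[OF DERIV_J] by (metis c(2) mult.assoc)
  qed
  have one: "1 \<notin> t ` {1..<N}"
    using node_interior by fastforce
  have "(S has_real_derivative (\<Sum>i=1..<N. - 1 / (1 - t i)\<^sup>2)) (at 1)"
    unfolding S_def
  proof (intro DERIV_sum)
    fix i assume "i \<in> {1..<N}"
    then have "1 - t i \<noteq> 0" using one by auto
    then show "((\<lambda>x. 1 / (x - t i)) has_real_derivative - 1 / (1 - t i)\<^sup>2) (at 1)"
      by (auto intro!: derivative_eq_intros simp: power2_eq_square)
  qed
  then obtain D where D: "(S has_real_derivative D) (at 1)" ..
  have "((\<lambda>x. (1 - x) * (J x * S x)) has_real_derivative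
      - 1 * (J 1 * S 1) + (deriv J 1 * S 1 + D * J 1) * (1 - 1)) (at 1)"
    by (intro DERIV_mult DERIV_J D) (auto intro!: derivative_eq_intros)
  moreover have "((\<lambda>x. (1 - x) * (J x * S x)) has_real_derivative deriv J 1 - real N * deriv K 1) (at 1)"
  proof (rule has_field_derivative_transform_within_open[where S = "- t ` {1..<N}"])
    show "((\<lambda>x. J x - real N * K x) has_real_derivative deriv J 1 - real N * deriv K 1) (at 1)"
      by (intro DERIV_diff DERIV_cmult DERIV_K DERIV_J)
    show "open (- t ` {1..<N})"
      by (intro open_Compl finite_imp_closed) auto
    show "J x - real N * K x = (1 - x) * (J x * S x)" if "x \<in> - t ` {1..<N}" for x
      using J_ode[of x] J'[of x] that by simp
  qed (use one in auto)
  ultimately have "- 1 * (J 1 * S 1) + (deriv J 1 * S 1 + D * J 1) * (1 - 1) = deriv J 1 - real N * deriv K 1"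
    by (rule DERIV_unique)
  then have 1: "2 * (J 1 * S 1) = real N * deriv K 1"
    unfolding J'[OF one] by (simp add: algebra_simps)
  have J1: "J 1 = real N * K 1"
    using J_ode[of 1] by (simp only: diff_self mult_zero_left right_minus_eq eq_commute[of 0])
  have "4 * (J 1 * S 1) = real N * (2 * deriv K 1)"
    using 1 by linarith
  also have "2 * deriv K 1 = real N * J 1 - K 1"
    using K_ode[of 1] by (simp only: one_add_one)
  finally have "(real N * K 1) * (4 * S 1) = (real N * K 1) * ((real N)\<^sup>2 - 1)"
    unfolding J1 by (simp only: power2_eq_square right_diff_distrib mult_ac mult_1_right mult_1_left)
  moreover have "real N * K 1 \<noteq> 0"
    using K_1 N_pos by auto
  ultimately have "4 * S 1 = (real N)\<^sup>2 - 1"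
    using mult_left_cancel by blast
  then have "S 1 = ((real N)\<^sup>2 - 1) / 4"
    by (simp add: eq_divide_eq mult.commute)
  then show ?thesis
    by (simp only: S_def)
qed

lemma G_node_nonneg: "i \<in> {1..N} \<Longrightarrow> G (t i) \<ge> 0"
  using G_node_pos by (rule less_imp_le)

text \<open>The lower bound for the weighted energy applies because interior nodes keep the required
  distance from the end points: on the left by \<open>node_ge\<close> with \<open>i \<ge> 1\<close>,
  on the right because one term \<open>1 / (1 - t i)\<close> is at most the whole sum.\<close>

lemma inverse_G_node_le:
  assumes "i \<in> {1..<N}"
  shows "1 / G (t i) \<le> 36 * real N * sqrt (1 - (t i)\<^sup>2)"
proof -
  have t: "-1 < t i" "t i < 1" using node_interior[OF assms] by auto
  have "(real 1)\<^sup>2 / (2 * (real N)\<^sup>2) \<le> (real i)\<^sup>2 / (2 * (real N)\<^sup>2)"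
    using assms by (intro divide_right_mono power_mono) auto
  then have left: "1 / (2 * (real N)\<^sup>2) \<le> 1 + t i"
    using node_ge[OF assms] by simp
  have "1 / (1 - t i) \<le> (\<Sum>j=1..<N. 1 / (1 - t j))"
    using assms node_interior by (intro member_le_sum) (auto intro: less_imp_le)
  then have "1 / (1 - t i) \<le> (real N)\<^sup>2 / 4"
    unfolding sum_inverse_1_minus by simp
  then have right: "4 / (real N)\<^sup>2 \<le> 1 - t i"
    using t N_pos by (simp add: field_simps)
  have "1 / (4 * (real N)\<^sup>2) \<le> 1 / (2 * (real N)\<^sup>2)" "1 / (4 * (real N)\<^sup>2) \<le> 4 / (real N)\<^sup>2"
    using N_pos by (simp_all add: field_simps)
  then have "\<bar>t i\<bar> \<le> 1 - 1 / (4 * (real N)\<^sup>2)"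
    using left right unfolding abs_le_iff by linarith
  then have "1 / (36 * real N) \<le> sqrt (1 - (t i)\<^sup>2) * G (t i)"
    using t by (intro weighted_G_bounds(2)) auto
  moreover have "G (t i) > 0"
    using assms by (intro G_node_pos) auto
  ultimately show ?thesis
    using N_pos by (simp add: field_simps)
qed

section \<open>Contributions of near and far nodes\<close>

lemma sum_abs_lagrange_node:
  assumes "j \<in> {1..N}"
  shows "(\<Sum>i=1..N. \<bar>lagrange_basis N t i (t j)\<bar>) = 1"
proof -
  have *: "lagrange_basis N t i (t j) = (if i = j then 1 else 0)" if i: "i \<in> {1..N}" for i
  proof (cases "i = j")
    case True
    have "t j - t k \<noteq> 0" if "k \<in> {1..N} - {j}" for k
      using inj_onD[OF inj_t, of j k] assms that by auto
    then show ?thesis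
      using True by (simp add: lagrange_basis_def)
  next
    case False
    then have "\<exists>k\<in>{1..N} - {i}. (t j - t k) / (t i - t k) = 0"
      using assms by (intro bexI[of _ j]) auto
    then show ?thesis
      using False by (simp add: lagrange_basis_def prod_zero_iff)
  qed
  have "(\<Sum>i=1..N. \<bar>lagrange_basis N t i (t j)\<bar>) = (\<Sum>i=1..N. if i = j then 1 else 0)"
    by (intro sum.cong) (auto simp: *)
  then show ?thesis
    using assms by simp
qed

text \<open>The weighted bounds say nothing at the node \<open>1\<close>, but its single term in the
  quadratic identity, with \<open>G 1 = 2\<close>, suffices.\<close>

lemma lagrange_N_le:
  assumes "x \<notin> t ` {1..N}" "\<bar>x\<bar> \<le> 1"
  shows "\<bar>lagrange_basis N t N x\<bar> \<le> 2"
proof -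
  have N: "N \<in> {1..N}" using N_ge_2 by simp
  have "(lagrange_basis N t N x)\<^sup>2 * G (t N) \<le> (\<Sum>i=1..N. (lagrange_basis N t i x)\<^sup>2 * G (t i))"
    using N by (intro member_le_sum) (auto intro!: mult_nonneg_nonneg G_node_nonneg)
  also have "\<dots> \<le> 4"
    using sum_lagrange_sq_G[OF assms(1)] G_le_4[OF assms(2)] by simp
  finally have "(lagrange_basis N t N x)\<^sup>2 \<le> 2\<^sup>2"
    by (simp add: t_N G_1)
  then show ?thesis
    using abs_le_square_iff[of "lagrange_basis N t N x" 2] by simp
qed

text \<open>Cauchy-Schwarz for the weights \<open>1 / G (t i)\<close>, applied termwise as AM-GM with the scale \<open>c\<close>.\<close>
lemma sum_lagrange_near:
  assumes "x \<notin> t ` {1..N}" "\<bar>x\<bar> \<le> 1"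
  shows "(\<Sum>i | i \<in> {1..<N} \<and> 1 - (t i)\<^sup>2 \<le> 4 * (1 - x\<^sup>2). \<bar>lagrange_basis N t i x\<bar>) \<le> 54 * sqrt (real N)"
    (is "sum _ ?S \<le> _")
proof (cases "\<bar>x\<bar> = 1")
  case True
  have "1 - (t i)\<^sup>2 > 0" if "i \<in> {1..<N}" for i
    using node_interior[OF that] by (simp add: abs_square_less_1 abs_less_iff)
  moreover have "x\<^sup>2 = 1" using True by (auto simp: abs_if split: if_splits)
  ultimately have S: "?S = {}" by force
  show ?thesis unfolding S by simp
next
  case False
  define w where "w = sqrt (1 - x\<^sup>2)"
  \<comment> \<open>Balances the two halves of AM-GM: from \<open>G x \<le> 36 / (N * w)\<close> and
    \<open>1 / G (t i) \<le> 72 * N * w\<close> they sum to at most \<open>36 * sqrt N\<close> and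
    \<open>72 * sqrt N\<close>, whose mean is \<open>54 * sqrt N\<close>.\<close>
  define c where "c = real N * w * sqrt (real N)"
  have x1: "\<bar>x\<bar> < 1" using False assms by simp
  then have w: "w > 0" by (simp add: w_def abs_square_less_1)
  have c: "c > 0" using w N_pos by (simp add: c_def)
  define L where "L i = \<bar>lagrange_basis N t i x\<bar>" for i
  have "L i \<le> (c * ((L i)\<^sup>2 * G (t i)) + 72 / sqrt (real N)) / 2" if i: "i \<in> ?S" for i
  proof -
    have "i \<in> {1..N}" using i by auto
    then have G: "G (t i) > 0" by (rule G_node_pos)
    have "sqrt (1 - (t i)\<^sup>2) \<le> sqrt (4 * (1 - x\<^sup>2))"
      using i by simp
    also have "\<dots> = 2 * w" unfolding w_def real_sqrt_mult by simp
    finally have "36 * real N * sqrt (1 - (t i)\<^sup>2) \<le> 36 * real N * (2 * w)"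
      by (intro mult_left_mono) auto
    moreover have "1 / G (t i) \<le> 36 * real N * sqrt (1 - (t i)\<^sup>2)"
      using i by (intro inverse_G_node_le) auto
    ultimately have "1 / G (t i) \<le> 72 * (real N * w)" by linarith
    then have "1 / G (t i) / c \<le> 72 * (real N * w) / c"
      using c by (intro divide_right_mono) auto
    also have "\<dots> = 72 / sqrt (real N)"
      using w N_pos by (simp add: c_def)
    finally have 1: "1 / (c * G (t i)) \<le> 72 / sqrt (real N)"
      by (simp add: mult.commute)
    define g where "g = c * G (t i)"
    have g: "g > 0" using c G by (simp add: g_def)
    have "0 \<le> (g * L i - 1)\<^sup>2 / g" using g by simp
    also have "\<dots> = g * (L i)\<^sup>2 + 1 / g - 2 * L i"
      using g by (simp add: field_simps power2_eq_square)
    finally show ?thesis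
      using 1 by (simp add: g_def mult_ac)
  qed
  then have "sum L ?S \<le> (\<Sum>i\<in>?S. (c * ((L i)\<^sup>2 * G (t i)) + 72 / sqrt (real N)) / 2)"
    by (rule sum_mono)
  also have "\<dots> \<le> (\<Sum>i=1..N. (c * ((L i)\<^sup>2 * G (t i)) + 72 / sqrt (real N)) / 2)"
    using c by (intro sum_mono2) (auto intro!: add_nonneg_nonneg mult_nonneg_nonneg G_node_nonneg)
  also have "\<dots> = (c * (\<Sum>i=1..N. (L i)\<^sup>2 * G (t i)) + real N * (72 / sqrt (real N))) / 2"
    by (simp add: sum.distrib sum_distrib_left flip: sum_divide_distrib)
  also have "(\<Sum>i=1..N. (L i)\<^sup>2 * G (t i)) = G x"
    using sum_lagrange_sq_G[OF assms(1)] by (simp add: L_def)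
  also have "c * G x = real N * sqrt (real N) * (w * G x)"
    by (simp add: c_def)
  also have "real N * (72 / sqrt (real N)) = 72 * sqrt (real N)"
  proof -
    have "real N * (72 / sqrt (real N)) = 72 * (real N / sqrt (real N))" by simp
    then show ?thesis by (simp only: real_div_sqrt of_nat_0_le_iff)
  qed
  also have "(real N * sqrt (real N) * (w * G x) + 72 * sqrt (real N)) / 2
      \<le> (real N * sqrt (real N) * (36 / real N) + 72 * sqrt (real N)) / 2"
    using weighted_G_bounds(1)[OF x1]
    by (intro divide_right_mono add_mono mult_left_mono) (auto simp: w_def)
  also have "\<dots> = 54 * sqrt (real N)"
    using N_pos by simp
  finally show ?thesis by (simp add: L_def)
qed

text \<open>The explicit formula for \<open>R_i\<close>, with \<open>(K (t i))\<^sup>2\<close>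
  replaced by \<open>G (t i) / (1 + t i)\<close> and then by the lower bound for
  \<open>G (t i)\<close>.\<close>

lemma sq_lagrange_le:
  assumes "i \<in> {1..<N}" "0 < d" "d \<le> \<bar>t i - x\<bar>"
  shows "(lagrange_basis N t i x)\<^sup>2
      \<le> 36 * sqrt (1 - (t i)\<^sup>2) * (1 + t i) * ((1 - x) * J x)\<^sup>2 / (real N * d\<^sup>2)"
proof -
  define L where "L = lagrange_basis N t i x"
  have i: "i \<in> {1..N}" using assms by auto
  have G: "G (t i) > 0" using i by (rule G_node_pos)
  have t: "1 + t i > 0" using t_bounds[OF i] by simp
  have "L\<^sup>2 * (real N)\<^sup>2 * (K (t i))\<^sup>2 * d\<^sup>2 \<le> L\<^sup>2 * (real N)\<^sup>2 * (K (t i))\<^sup>2 * \<bar>t i - x\<bar>\<^sup>2"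
    using assms by (intro mult_left_mono power_mono) auto
  also have "\<dots> = ((1 - x) * J x)\<^sup>2"
    unfolding lagrange_basis_eq[OF i, of x, symmetric] L_def by (simp add: power_mult_distrib)
  finally have "(1 + t i) * (L\<^sup>2 * (real N)\<^sup>2 * (K (t i))\<^sup>2 * d\<^sup>2) \<le> (1 + t i) * ((1 - x) * J x)\<^sup>2"
    using t by (intro mult_left_mono) auto
  then have "(L\<^sup>2 * ((real N)\<^sup>2 * d\<^sup>2)) * G (t i) \<le> (1 + t i) * ((1 - x) * J x)\<^sup>2"
    by (simp add: G_node[OF i] mult_ac)
  then have "L\<^sup>2 * ((real N)\<^sup>2 * d\<^sup>2) \<le> (1 / G (t i)) * ((1 + t i) * ((1 - x) * J x)\<^sup>2)"
    using G by (simp add: field_simps)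
  also have "\<dots> \<le> (36 * real N * sqrt (1 - (t i)\<^sup>2)) * ((1 + t i) * ((1 - x) * J x)\<^sup>2)"
    using inverse_G_node_le[OF assms(1)] t by (intro mult_right_mono) auto
  finally have "(L\<^sup>2 * (real N * d\<^sup>2)) * real N
      \<le> (36 * sqrt (1 - (t i)\<^sup>2) * ((1 + t i) * ((1 - x) * J x)\<^sup>2)) * real N"
    by (simp add: power2_eq_square mult_ac)
  then have "L\<^sup>2 * (real N * d\<^sup>2) \<le> 36 * sqrt (1 - (t i)\<^sup>2) * ((1 + t i) * ((1 - x) * J x)\<^sup>2)"
    using N_pos by (rule mult_right_le_imp_le)
  then show ?thesis
    using N_pos assms(2) by (simp add: L_def pos_le_divide_eq mult_ac)
qed

text \<open>For a far node, \<open>1 + x\<close> is at most half of \<open>s = 1 + t i\<close>, so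
  \<open>x\<close> is at least \<open>s / 2\<close> away from \<open>t i\<close>. The node
  polynomial is bounded by \<open>2\<close>.\<close>

lemma lagrange_far_left:
  assumes "i \<in> {1..<N}" "-1 \<le> x" "x \<le> 0" "4 * (1 - x\<^sup>2) < 1 - (t i)\<^sup>2"
  shows "\<bar>lagrange_basis N t i x\<bar> \<le> 34 * (1 / sqrt (real i))"
proof -
  define s where "s = 1 + t i"
  have s: "0 < s" "s < 2"
    using node_interior[OF assms(1)] by (auto simp: s_def)
  have i: "real i > 0" using assms by simp
  have ts: "1 - (t i)\<^sup>2 = s * (2 - s)"
    by (simp add: s_def power2_eq_square algebra_simps)
  have "4 * (1 + x) \<le> 4 * (1 - x\<^sup>2)"
    using assms mult_nonneg_nonneg[of "- x" "1 + x"] by (simp add: algebra_simps power2_eq_square)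
  also have "\<dots> \<le> s * (2 - s)" using assms(4) ts by simp
  also have "\<dots> \<le> s * 2" using s by (intro mult_left_mono) auto
  finally have d: "s / 2 \<le> \<bar>t i - x\<bar>" by (simp add: s_def abs_if)
  have "\<bar>(1 - x) * J x\<bar> \<le> 2" using assms by (intro abs_J_le_2) auto
  then have "((1 - x) * J x)\<^sup>2 \<le> 2\<^sup>2"
    using abs_le_square_iff[of "(1 - x) * J x" 2] by simp
  then have \<omega>: "((1 - x) * J x)\<^sup>2 \<le> 4" by simp
  \<comment> \<open>\<open>node_ge\<close> trades a square root of \<open>s\<close> for a full
    factor \<open>s\<close>, so that \<open>s\<close> and \<open>N\<close> cancel in the final
    quotient.\<close>
  have "sqrt (s * (2 - s)) \<le> 2 * real N * s / real i"
  proof (rule real_le_lsqrt)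
    have "s * (2 - s) \<le> 2 * s" using s by (simp add: algebra_simps)
    also have "\<dots> = 4 * (real N)\<^sup>2 * s / (real i)\<^sup>2 * ((real i)\<^sup>2 / (2 * (real N)\<^sup>2))"
      using N_pos i by (simp add: field_simps)
    also have "\<dots> \<le> 4 * (real N)\<^sup>2 * s / (real i)\<^sup>2 * s"
      using node_ge[OF assms(1)] s by (intro mult_left_mono) (auto simp: s_def)
    also have "\<dots> = (2 * real N * s / real i)\<^sup>2"
      by (simp add: power2_eq_square)
    finally show "s * (2 - s) \<le> (2 * real N * s / real i)\<^sup>2" .
  qed (use s i in auto)
  then have w: "sqrt (1 - (t i)\<^sup>2) \<le> 2 * real N * s / real i" by (simp add: ts)
  have w0: "0 \<le> sqrt (1 - (t i)\<^sup>2)"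
    using s by (simp add: ts)
  have "(lagrange_basis N t i x)\<^sup>2
      \<le> 36 * sqrt (1 - (t i)\<^sup>2) * s * ((1 - x) * J x)\<^sup>2 / (real N * (s / 2)\<^sup>2)"
    using sq_lagrange_le[OF assms(1) _ d] s by (simp add: s_def)
  also have "\<dots> \<le> 36 * (2 * real N * s / real i) * s * 4 / (real N * (s / 2)\<^sup>2)"
    using w w0 \<omega> s i N_pos by (intro divide_right_mono mult_mono) auto
  also have "\<dots> = 1152 / real i"
    using s i N_pos by (simp add: field_simps power2_eq_square)
  \<comment> \<open>\<open>34\<^sup>2 = 1156\<close>.\<close>
  also have "\<dots> \<le> (34 * (1 / sqrt (real i)))\<^sup>2"
    using i by (simp add: power2_eq_square field_simps)
  finally show ?thesis
    using abs_le_square_iff[of "lagrange_basis N t i x" "34 * (1 / sqrt (real i))"] by simp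
qed

text \<open>Again \<open>x\<close> is at least \<open>s / 2\<close> away from \<open>t i\<close>,
  now with \<open>s = 1 - t i\<close>, but the node polynomial is also small, which gives
  \<open>144 / (N * sqrt s)\<close>. AM-GM turns \<open>1 / sqrt s\<close> into
  \<open>1 / s\<close>, whose sum over the nodes is known exactly.\<close>

lemma lagrange_far_right:
  assumes "i \<in> {1..<N}" "0 \<le> x" "x < 1" "4 * (1 - x\<^sup>2) < 1 - (t i)\<^sup>2"
  shows "\<bar>lagrange_basis N t i x\<bar>
      \<le> 72 / real N * (sqrt (real N) + 1 / (1 - t i) * (1 / sqrt (real N)))"
proof -
  define s where "s = 1 - t i"
  have s: "0 < s" "s < 2"
    using node_interior[OF assms(1)] by (auto simp: s_def)
  have ts: "1 - (t i)\<^sup>2 = s * (2 - s)"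
    by (simp add: s_def power2_eq_square algebra_simps)
  have "4 * (1 - x) \<le> 4 * (1 - x\<^sup>2)"
    using assms mult_nonneg_nonneg[of x "1 - x"] by (simp add: algebra_simps power2_eq_square)
  also have "\<dots> \<le> s * (2 - s)" using assms(4) ts by simp
  also have "\<dots> \<le> s * 2" using s by (intro mult_left_mono) auto
  finally have xs: "1 - x \<le> s / 2" by simp
  then have d: "s / 2 \<le> \<bar>t i - x\<bar>" by (simp add: s_def abs_if)
  have "sqrt (s * (2 - s)) \<le> sqrt (s * 4)"
    using s by (intro real_sqrt_le_mono mult_left_mono) auto
  then have w: "sqrt (1 - (t i)\<^sup>2) \<le> 2 * sqrt s"
    by (simp add: ts real_sqrt_mult)
  define v where "v = sqrt (1 - x\<^sup>2)"
  have v: "v > 0" using assms by (simp add: v_def abs_square_less_1)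
  have "(1 - x) * 1 \<le> (1 - x) * (1 + x)"
    using assms by (intro mult_left_mono) auto
  also have "\<dots> = 1 - x\<^sup>2" by (simp add: power2_eq_square algebra_simps)
  finally have "sqrt (1 - x) \<le> v" by (simp add: v_def)
  \<comment> \<open>One square root is bounded by the far condition, the other becomes the weight
    \<open>v\<close> that controls \<open>G x\<close>.\<close>
  then have "sqrt (1 - x) * sqrt (1 - x) \<le> sqrt s * v"
    using xs s assms by (intro mult_mono) auto
  then have xv: "1 - x \<le> sqrt s * v" using assms by simp
  have "((1 - x) * J x)\<^sup>2 \<le> (1 - x) * G x"
    using assms by (intro sq_J_le) auto
  also have "\<dots> \<le> sqrt s * v * G x"
    using xv G_nonneg[of x] assms by (intro mult_right_mono) auto
  also have "\<dots> = sqrt s * (v * G x)" by simp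
  also have "\<dots> \<le> sqrt s * (36 / real N)"
    using weighted_G_bounds(1)[of x] assms s by (intro mult_left_mono) (auto simp: v_def)
  finally have \<omega>: "((1 - x) * J x)\<^sup>2 \<le> sqrt s * (36 / real N)" .
  have am_gm: "1 / sqrt s \<le> (sqrt (real N) + 1 / s * (1 / sqrt (real N))) / 2"
  proof -
    define a b where "a = sqrt s" and "b = sqrt (real N)"
    have ab: "a > 0" "b > 0" "s = a * a" using s N_pos by (simp_all add: a_def b_def)
    have "0 \<le> (a * b - 1)\<^sup>2 / (a * a * b)" using ab by simp
    also have "\<dots> = b + 1 / (a * a) * (1 / b) - 2 * (1 / a)"
      using ab by (simp add: field_simps power2_eq_square)
    finally show ?thesis
      unfolding a_def[symmetric] b_def[symmetric] unfolding ab(3) by simp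
  qed
  have half: "144 / real N * (y / 2) = 72 / real N * y" for y :: real by simp
  have w0: "0 \<le> sqrt (1 - (t i)\<^sup>2)"
    using s by (simp add: ts)
  have "(lagrange_basis N t i x)\<^sup>2
      \<le> 36 * sqrt (1 - (t i)\<^sup>2) * (1 + t i) * ((1 - x) * J x)\<^sup>2 / (real N * (s / 2)\<^sup>2)"
    using sq_lagrange_le[OF assms(1) _ d] s by simp
  also have "\<dots> \<le> 36 * (2 * sqrt s) * 2 * (sqrt s * (36 / real N)) / (real N * (s / 2)\<^sup>2)"
    using w w0 \<omega> s N_pos by (intro divide_right_mono mult_mono) (auto simp: s_def)
  also have "\<dots> = (sqrt s * sqrt s) * 20736 / ((real N)\<^sup>2 * s\<^sup>2)"
    by (simp add: field_simps power2_eq_square)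
  also have "\<dots> = (144 / real N * (1 / sqrt s))\<^sup>2"
    using s by (simp add: power2_eq_square power_mult_distrib)
  finally have "\<bar>lagrange_basis N t i x\<bar> \<le> 144 / real N * (1 / sqrt s)"
    using abs_le_square_iff[of "lagrange_basis N t i x" "144 / real N * (1 / sqrt s)"] s by simp
  also have "\<dots> \<le> 144 / real N * ((sqrt (real N) + 1 / s * (1 / sqrt (real N))) / 2)"
    using am_gm by (intro mult_left_mono) auto
  finally show ?thesis
    unfolding s_def half .
qed

text \<open>On the left half the sum of \<open>1 / sqrt i\<close> gives \<open>68 * sqrt N\<close>.
  On the right half the two parts of the termwise bound give \<open>72 * sqrt N\<close> and
  \<open>18 * sqrt N\<close>.\<close>

lemma sum_lagrange_far:
  assumes "x \<in> {-1..<1}"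
  shows "(\<Sum>i | i \<in> {1..<N} \<and> \<not> 1 - (t i)\<^sup>2 \<le> 4 * (1 - x\<^sup>2). \<bar>lagrange_basis N t i x\<bar>) \<le> 90 * sqrt (real N)"
    (is "sum _ ?S \<le> _")
proof (cases "x \<le> 0")
  case True
  have "(\<Sum>i\<in>?S. \<bar>lagrange_basis N t i x\<bar>) \<le> (\<Sum>i\<in>?S. 34 * (1 / sqrt (real i)))"
    using True assms by (intro sum_mono lagrange_far_left) auto
  also have "\<dots> \<le> (\<Sum>i=1..N. 34 * (1 / sqrt (real i)))"
    by (intro sum_mono2) auto
  also have "\<dots> \<le> 34 * (2 * sqrt (real N))"
    unfolding sum_distrib_left[symmetric] using sum_inverse_sqrt_le[of N] by (intro mult_left_mono) auto
  finally show ?thesis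
    by (rule order_trans) simp
next
  case False
  let ?u = "\<lambda>i. 72 / real N * (sqrt (real N) + 1 / (1 - t i) * (1 / sqrt (real N)))"
  have "(\<Sum>i\<in>?S. \<bar>lagrange_basis N t i x\<bar>) \<le> sum ?u ?S"
    using False assms by (intro sum_mono lagrange_far_right) auto
  also have "\<dots> \<le> sum ?u {1..<N}"
  proof (intro sum_mono2)
    show "0 \<le> ?u i" if "i \<in> {1..<N} - ?S" for i
      using node_interior[of i] that by (intro mult_nonneg_nonneg add_nonneg_nonneg) auto
  qed auto
  also have "\<dots> = 72 / real N * ((real N - 1) * sqrt (real N)
      + (\<Sum>i=1..<N. 1 / (1 - t i)) * (1 / sqrt (real N)))"
    using N_ge_2 unfolding sum_distrib_left[symmetric] sum.distrib sum_distrib_right[symmetric]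
    by (simp add: of_nat_diff)
  also have "\<dots> \<le> 72 / real N * (real N * sqrt (real N) + ((real N)\<^sup>2 / 4) * (1 / sqrt (real N)))"
    unfolding sum_inverse_1_minus by (intro mult_left_mono add_mono mult_right_mono) auto
  also have "(real N)\<^sup>2 / 4 * (1 / sqrt (real N)) = real N / 4 * (real N / sqrt (real N))"
    by (simp add: power2_eq_square)
  also have "real N / sqrt (real N) = sqrt (real N)"
    by (simp add: real_div_sqrt)
  also have "72 / real N * (real N * sqrt (real N) + real N / 4 * sqrt (real N)) = 90 * sqrt (real N)"
    using N_pos by (simp add: field_simps)
  finally show ?thesis .
qed

lemma lebesgue_constant_le: "lebesgue_constant N t \<le> 146 * sqrt (real N)"
  unfolding lebesgue_constant_def
proof (rule cSUP_least)
  fix x :: real assume x: "x \<in> {-1..1}"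
  have sqrt1: "1 \<le> sqrt (real N)" using N_ge_2 by simp
  show "(\<Sum>i=1..N. \<bar>lagrange_basis N t i x\<bar>) \<le> 146 * sqrt (real N)"
  proof (cases "x \<in> t ` {1..N}")
    case True
    then obtain j where "j \<in> {1..N}" "x = t j" by blast
    then have "(\<Sum>i=1..N. \<bar>lagrange_basis N t i x\<bar>) = 1"
      using sum_abs_lagrange_node[of j] by simp
    then show ?thesis using sqrt1 by linarith
  next
    case False
    have "x \<noteq> 1" using False t_N N_ge_2 by (metis atLeastAtMost_iff imageI le_refl one_le_numeral order_trans)
    let ?L = "\<lambda>i. \<bar>lagrange_basis N t i x\<bar>"
    have "sum ?L {1..N} = ?L N + sum ?L {1..<N}"
      unfolding atLeastAtMost_N by simp
    also have "sum ?L {1..<N} = sum ?L {i. i \<in> {1..<N} \<and> 1 - (t i)\<^sup>2 \<le> 4 * (1 - x\<^sup>2)}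
        + sum ?L {i. i \<in> {1..<N} \<and> \<not> 1 - (t i)\<^sup>2 \<le> 4 * (1 - x\<^sup>2)}"
      by (subst sum.union_disjoint[symmetric]) (auto intro!: sum.cong)
    \<comment> \<open>The node \<open>1\<close>, the near nodes and the far nodes; the isolated
      \<open>2\<close> is absorbed by \<open>1 \<le> sqrt N\<close>, whence the constant
      \<open>146\<close>.\<close>
    also have "?L N + \<dots> \<le> 2 + (54 * sqrt (real N) + 90 * sqrt (real N))"
      using x \<open>x \<noteq> 1\<close> by (intro add_mono lagrange_N_le sum_lagrange_near sum_lagrange_far False) auto
    finally show ?thesis using sqrt1 by linarith
  qed
qed auto

end

theorem theorem5p1:
  "\<exists>C::real. \<forall>N::nat. \<forall>\<tau>::nat \<Rightarrow> real.
     N \<ge> 2 \<longrightarrow>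
     (\<forall>i\<in>{1..N-1}. -1 < \<tau> i \<and> \<tau> i < 1 \<and> jacobiP (N - 1) 1 0 (\<tau> i) = 0) \<longrightarrow>
     (\<forall>i\<in>{1..<N-1}. \<tau> i < \<tau> (i + 1)) \<longrightarrow>
     \<tau> N = 1 \<longrightarrow>
     lebesgue_constant N \<tau> \<le> C * sqrt (real N)"
proof (intro exI allI impI)
  fix N :: nat and \<tau> :: "nat \<Rightarrow> real"
  assume N: "N \<ge> 2"
    and zeros: "\<forall>i\<in>{1..N-1}. -1 < \<tau> i \<and> \<tau> i < 1 \<and> jacobiP (N - 1) 1 0 (\<tau> i) = 0"
    and step: "\<forall>i\<in>{1..<N-1}. \<tau> i < \<tau> (i + 1)"
    and "\<tau> N = 1"
  interpret radau N \<tau>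
  proof
    show "- 1 < \<tau> i \<and> \<tau> i < 1 \<and> jacobiP (N - 1) 1 0 (\<tau> i) = 0" if "i \<in> {1..<N}" for i
      using zeros that by auto
    show "\<tau> i < \<tau> (Suc i)" if "1 \<le> i" "Suc i < N" for i
      using bspec[OF step, of i] that by auto
  qed fact+
  show "lebesgue_constant N \<tau> \<le> 146 * sqrt (real N)"
    by (rule lebesgue_constant_le)
qed

end
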